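(* For every infinite cardinal $\kappa$, the von Neumann algebra $\mathcal A_\kappa$ is abelian, $\sigma$-finite, non-atomic and $\kappa$-homogeneous.
   Context: Definition of $\mathcal A_\kappa$: let $\tau(a,b)=\frac12(a+b)$ be the normalized trace on $\mathbb C^2$. Let $A_\kappa=(\mathbb C^2)^{\otimes\kappa}$ be the $C^*$-algebraic infinite tensor product of $\kappa$ copies of $\mathbb C^2$, i.e. the $C^*$-inductive limit of the finite tensor products $A_F=\bigotimes_{i\in F}\mathbb C^2$ over finite $F\subset\kappa$ with connecting maps $a\mapsto a\otimes 1_{G\setminus F}$ for $F\subseteq G$. Let $\varphi_\kappa$ be the product state, i.e. the unique state on $A_\kappa$ with $\varphi_\kappa(\bigotimes_{i\in F}a_i)=\prod_{i\in F}\tau(a_i)$ for all finite $F\subset\kappa$ and $a_i\in\mathbb C^2$. Then $\mathcal A_\kappa=\pi(A_\kappa)''$ where $\pi$ is the GNS representation of $\varphi_\kappa$. A von Neumann algebra is $\sigma$-finite if the maximal cardinality of a family of nonzero mutually orthogonal projections in it is $\aleph_0$; it is non-atomic if it has no minimal projections. For an abelian von Neumann algebra $\mathcal A$, $\mathfrak k(\mathcal A)$ is the smallest cardinality of a set of projections generating $\mathcal A$ as a von Neumann algebra (von Neumann subalgebras contain the unit; $\mathfrak k(\mathcal A)=0$ if $\mathcal A$ is one-dimensional). $\mathcal A$ is $\kappa$-homogeneous if $\kappa=\mathfrak k(\mathcal A)=\mathfrak k(\mathcal A p)$ for every nonzero projection $p\in\mathcal A$, where $\mathcal A p$ is regarded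 as a von Neumann algebra with unit $p$. *)

theory Defs
  imports "HOL-Analysis.Analysis" "HOL-Algebra.Ring"
begin

unbundle cardinal_syntax

section \<open>Complex Hilbert spaces\<close>

class scaleC =
  fixes scaleC :: "complex \<Rightarrow> 'a \<Rightarrow> 'a"  (infixr \<open>*\<^sub>C\<close> 75)

text \<open>The inner product \<open>cinner\<close> is linear in the first and conjugate-linear in the second
  argument. Norm and topology are those of the underlying real Hilbert space.\<close>

class complex_hilbert_space = real_inner + complete_space + scaleC +
  fixes cinner :: "'a \<Rightarrow> 'a \<Rightarrow> complex"
  assumes scaleC_add_right: "c *\<^sub>C (x + y) = c *\<^sub>C x + c *\<^sub>C y"
    and scaleC_add_left: "(c + d) *\<^sub>C x = c *\<^sub>C x + d *\<^sub>C x"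
    and scaleC_scaleC: "c *\<^sub>C d *\<^sub>C x = (c * d) *\<^sub>C x"
    and scaleC_of_real: "of_real r *\<^sub>C x = r *\<^sub>R x"
    and cinner_add_left: "cinner (x + y) z = cinner x z + cinner y z"
    and cinner_scaleC_left: "cinner (c *\<^sub>C x) y = c * cinner x y"
    and cinner_commute: "cinner y x = cnj (cinner x y)"
    and inner_eq_Re_cinner: "inner x y = Re (cinner x y)"

definition bounded_ops :: "('h::complex_hilbert_space \<Rightarrow> 'h) set" where
  "bounded_ops = {T. bounded_linear T \<and> (\<forall>c x. T (c *\<^sub>C x) = c *\<^sub>C T x)}"

definition is_adjoint ::
    "('h::complex_hilbert_space \<Rightarrow> 'h) \<Rightarrow> ('h \<Rightarrow> 'h) \<Rightarrow> bool" where
  "is_adjoint S T \<longleftrightarrow> (\<forall>x y. cinner (S x) y = cinner x (T y))"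

definition projection :: "('h::complex_hilbert_space \<Rightarrow> 'h) \<Rightarrow> bool" where
  "projection p \<longleftrightarrow> p \<in> bounded_ops \<and> p \<circ> p = p \<and> is_adjoint p p"


section \<open>Von Neumann algebras\<close>

text \<open>For a projection \<open>p\<close>, the bounded operators on the Hilbert space \<open>pH\<close> are identified with
  the bounded operators \<open>T\<close> on \<open>H\<close> such that \<open>pTp = T\<close>. Commutants, von Neumann algebras and
  generation are all taken on \<open>pH\<close>, so that \<open>p\<close> is the unit. Algebras acting on all of \<open>H\<close> are
  obtained for \<open>p = id\<close>.\<close>

definition commutant ::
    "('h::complex_hilbert_space \<Rightarrow> 'h) \<Rightarrow> ('h \<Rightarrow> 'h) set \<Rightarrow> ('h \<Rightarrow> 'h) set" where
  "commutant p S = {T \<in> bounded_ops. p \<circ> T \<circ> p = T \<and> (\<forall>s\<in>S. T \<circ> s = s \<circ> T)}"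

definition von_neumann_algebra ::
    "('h::complex_hilbert_space \<Rightarrow> 'h) \<Rightarrow> ('h \<Rightarrow> 'h) set \<Rightarrow> bool" where
  "von_neumann_algebra p M \<longleftrightarrow>
     projection p \<and> (\<forall>T\<in>M. \<exists>S\<in>M. is_adjoint S T) \<and> commutant p (commutant p M) = M"

definition vn_generated ::
    "('h::complex_hilbert_space \<Rightarrow> 'h) \<Rightarrow> ('h \<Rightarrow> 'h) set \<Rightarrow> ('h \<Rightarrow> 'h) set" where
  "vn_generated p S = \<Inter>{M. von_neumann_algebra p M \<and> S \<subseteq> M}"

definition vn_abelian :: "('h::complex_hilbert_space \<Rightarrow> 'h) set \<Rightarrow> bool" where
  "vn_abelian M \<longleftrightarrow> (\<forall>S\<in>M. \<forall>T\<in>M. S \<circ> T = T \<circ> S)"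

text \<open>A family of nonzero mutually orthogonal projections is injective, hence may be regarded as
  a set.\<close>

definition orthogonal_projections ::
    "('h::complex_hilbert_space \<Rightarrow> 'h) set \<Rightarrow> ('h \<Rightarrow> 'h) set \<Rightarrow> bool" where
  "orthogonal_projections M P \<longleftrightarrow>
     P \<subseteq> {p \<in> M. projection p \<and> p \<noteq> (\<lambda>_. 0)} \<and>
     (\<forall>p\<in>P. \<forall>q\<in>P. p \<noteq> q \<longrightarrow> p \<circ> q = (\<lambda>_. 0))"

definition vn_sigma_finite :: "('h::complex_hilbert_space \<Rightarrow> 'h) set \<Rightarrow> bool" where
  "vn_sigma_finite M \<longleftrightarrow>
     (\<exists>P. orthogonal_projections M P \<and> |P| =o natLeq) \<and>
     (\<forall>P. orthogonal_projections M P \<longrightarrow> |P| \<le>o natLeq)"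

definition minimal_projection ::
    "('h::complex_hilbert_space \<Rightarrow> 'h) set \<Rightarrow> ('h \<Rightarrow> 'h) \<Rightarrow> bool" where
  "minimal_projection M p \<longleftrightarrow>
     p \<in> M \<and> projection p \<and> p \<noteq> (\<lambda>_. 0) \<and>
     (\<forall>q\<in>M. projection q \<and> p \<circ> q = q \<longrightarrow> q = (\<lambda>_. 0) \<or> q = p)"

definition vn_non_atomic :: "('h::complex_hilbert_space \<Rightarrow> 'h) set \<Rightarrow> bool" where
  "vn_non_atomic M \<longleftrightarrow> (\<nexists>p. minimal_projection M p)"

definition generating_projections ::
    "('h::complex_hilbert_space \<Rightarrow> 'h) \<Rightarrow> ('h \<Rightarrow> 'h) set \<Rightarrow> ('h \<Rightarrow> 'h) set \<Rightarrow> bool" where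
  "generating_projections p M S \<longleftrightarrow> S \<subseteq> {q \<in> M. projection q} \<and> vn_generated p S = M"

text \<open>The invariant \<open>\<kk>(M)\<close> of a von Neumann algebra \<open>M\<close> with unit \<open>p\<close>. Since the empty
  set generates the multiples of the unit, it vanishes for one-dimensional \<open>M\<close>.\<close>

definition vn_gen_card ::
    "('h::complex_hilbert_space \<Rightarrow> 'h) \<Rightarrow> ('h \<Rightarrow> 'h) set \<Rightarrow> ('h \<Rightarrow> 'h) rel" where
  "vn_gen_card p M =
     |SOME S. generating_projections p M S \<and>
        (\<forall>S'. generating_projections p M S' \<longrightarrow> |S| \<le>o |S'| )|"

definition vn_homogeneous ::
    "'k rel \<Rightarrow> ('h::complex_hilbert_space \<Rightarrow> 'h) set \<Rightarrow> bool" where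
  "vn_homogeneous \<kappa> M \<longleftrightarrow>
     \<kappa> =o vn_gen_card id M \<and>
     (\<forall>p\<in>M. projection p \<and> p \<noteq> (\<lambda>_. 0) \<longrightarrow> \<kappa> =o vn_gen_card p {T \<circ> p | T. T \<in> M})"


section \<open>Unital $C^*$-algebras, inductive limits and the GNS representation\<close>

record 'a cstar = "'a ring" +
  scale :: "complex \<Rightarrow> 'a \<Rightarrow> 'a"
  star :: "'a \<Rightarrow> 'a"
  cnorm :: "'a \<Rightarrow> real"

locale cstar_algebra = ring A for A :: "'a cstar" (structure) +
  assumes scale_closed: "x \<in> carrier A \<Longrightarrow> scale A c x \<in> carrier A"
    and scale_add_right: "\<lbrakk>x \<in> carrier A; y \<in> carrier A\<rbrakk> \<Longrightarrow>
          scale A c (x \<oplus> y) = scale A c x \<oplus> scale A c y"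
    and scale_add_left: "x \<in> carrier A \<Longrightarrow> scale A (c + d) x = scale A c x \<oplus> scale A d x"
    and scale_scale: "x \<in> carrier A \<Longrightarrow> scale A c (scale A d x) = scale A (c * d) x"
    and scale_one: "x \<in> carrier A \<Longrightarrow> scale A 1 x = x"
    and scale_mult_left: "\<lbrakk>x \<in> carrier A; y \<in> carrier A\<rbrakk> \<Longrightarrow>
          scale A c x \<otimes> y = scale A c (x \<otimes> y)"
    and scale_mult_right: "\<lbrakk>x \<in> carrier A; y \<in> carrier A\<rbrakk> \<Longrightarrow>
          x \<otimes> scale A c y = scale A c (x \<otimes> y)"
    and star_closed: "x \<in> carrier A \<Longrightarrow> star A x \<in> carrier A"
    and star_star: "x \<in> carrier A \<Longrightarrow> star A (star A x) = x"
    and star_add: "\<lbrakk>x \<in> carrier A; y \<in> carrier A\<rbrakk> \<Longrightarrow>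
          star A (x \<oplus> y) = star A x \<oplus> star A y"
    and star_scale: "x \<in> carrier A \<Longrightarrow> star A (scale A c x) = scale A (cnj c) (star A x)"
    and star_mult: "\<lbrakk>x \<in> carrier A; y \<in> carrier A\<rbrakk> \<Longrightarrow>
          star A (x \<otimes> y) = star A y \<otimes> star A x"
    and cnorm_nonneg: "x \<in> carrier A \<Longrightarrow> 0 \<le> cnorm A x"
    and cnorm_eq_0: "x \<in> carrier A \<Longrightarrow> cnorm A x = 0 \<longleftrightarrow> x = \<zero>"
    and cnorm_triangle: "\<lbrakk>x \<in> carrier A; y \<in> carrier A\<rbrakk> \<Longrightarrow>
          cnorm A (x \<oplus> y) \<le> cnorm A x + cnorm A y"
    and cnorm_scale: "x \<in> carrier A \<Longrightarrow> cnorm A (scale A c x) = cmod c * cnorm A x"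
    and cnorm_mult: "\<lbrakk>x \<in> carrier A; y \<in> carrier A\<rbrakk> \<Longrightarrow>
          cnorm A (x \<otimes> y) \<le> cnorm A x * cnorm A y"
    and cstar_identity: "x \<in> carrier A \<Longrightarrow> cnorm A (star A x \<otimes> x) = (cnorm A x)\<^sup>2"
    and complete: "\<lbrakk>\<And>n. X n \<in> carrier A;
            \<forall>e>0. \<exists>N. \<forall>m\<ge>N. \<forall>n\<ge>N. cnorm A (X m \<ominus> X n) < e\<rbrakk> \<Longrightarrow>
          \<exists>x\<in>carrier A. (\<lambda>n. cnorm A (X n \<ominus> x)) \<longlonglongrightarrow> 0"

definition cstar_hom :: "'a cstar \<Rightarrow> 'b cstar \<Rightarrow> ('a \<Rightarrow> 'b) \<Rightarrow> bool" where
  "cstar_hom A B f \<longleftrightarrow>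
     f \<in> ring_hom A B \<and>
     (\<forall>x\<in>carrier A. (\<forall>c. f (scale A c x) = scale B c (f x)) \<and> f (star A x) = star B (f x))"

definition cstar_system ::
    "'i::order set \<Rightarrow> ('i \<Rightarrow> 'b cstar) \<Rightarrow> ('i \<Rightarrow> 'i \<Rightarrow> 'b \<Rightarrow> 'b) \<Rightarrow> bool" where
  "cstar_system I A f \<longleftrightarrow>
     I \<noteq> {} \<and> (\<forall>i\<in>I. \<forall>j\<in>I. \<exists>k\<in>I. i \<le> k \<and> j \<le> k) \<and>
     (\<forall>i\<in>I. cstar_algebra (A i)) \<and>
     (\<forall>i\<in>I. \<forall>j\<in>I. i \<le> j \<longrightarrow> cstar_hom (A i) (A j) (f i j)) \<and>
     (\<forall>i\<in>I. \<forall>a\<in>carrier (A i). f i i a = a) \<and>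
     (\<forall>i\<in>I. \<forall>j\<in>I. \<forall>k\<in>I. i \<le> j \<longrightarrow> j \<le> k \<longrightarrow>
        (\<forall>a\<in>carrier (A i). f j k (f i j a) = f i k a))"

text \<open>The $C^*$-inductive limit is the completion of the algebraic direct limit for the norm
  $\|\iota_i(a)\| = \lim_j \|f_{ij}(a)\|$. The net is decreasing because *-homomorphisms are
  contractive, so the limit is an infimum. These data determine \<open>(L, \<iota>)\<close> up to a unique
  isomorphism.\<close>

definition cstar_inductive_limit ::
    "'i::order set \<Rightarrow> ('i \<Rightarrow> 'b cstar) \<Rightarrow> ('i \<Rightarrow> 'i \<Rightarrow> 'b \<Rightarrow> 'b) \<Rightarrow>
     'a cstar \<Rightarrow> ('i \<Rightarrow> 'b \<Rightarrow> 'a) \<Rightarrow> bool" where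
  "cstar_inductive_limit I A f L \<iota> \<longleftrightarrow>
     cstar_system I A f \<and> cstar_algebra L \<and>
     (\<forall>i\<in>I. cstar_hom (A i) L (\<iota> i)) \<and>
     (\<forall>i\<in>I. \<forall>j\<in>I. i \<le> j \<longrightarrow> (\<forall>a\<in>carrier (A i). \<iota> j (f i j a) = \<iota> i a)) \<and>
     (\<forall>i\<in>I. \<forall>a\<in>carrier (A i).
        cnorm L (\<iota> i a) = (INF j\<in>{j\<in>I. i \<le> j}. cnorm (A j) (f i j a))) \<and>
     (\<forall>x\<in>carrier L. \<forall>e>0. \<exists>i\<in>I. \<exists>a\<in>carrier (A i). cnorm L (x \<ominus>\<^bsub>L\<^esub> \<iota> i a) < e)"

definition cstar_state :: "'a cstar \<Rightarrow> ('a \<Rightarrow> complex) \<Rightarrow> bool" where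
  "cstar_state A \<phi> \<longleftrightarrow>
     (\<forall>x\<in>carrier A. \<forall>y\<in>carrier A. \<phi> (x \<oplus>\<^bsub>A\<^esub> y) = \<phi> x + \<phi> y) \<and>
     (\<forall>x\<in>carrier A. \<forall>c. \<phi> (scale A c x) = c * \<phi> x) \<and>
     (\<forall>x\<in>carrier A. \<phi> (star A x \<otimes>\<^bsub>A\<^esub> x) \<in> \<real>\<^sub>\<ge>\<^sub>0) \<and>
     (\<forall>x\<in>carrier A. cmod (\<phi> x) \<le> cnorm A x) \<and>
     \<phi> \<one>\<^bsub>A\<^esub> = 1"

text \<open>The GNS construction: through \<open>\<eta>\<close>, the Hilbert space \<open>'h\<close> is the completion of \<open>A\<close> for
  the positive semidefinite form $(a, b) \mapsto \varphi(b^* a)$ (modulo its null space), and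
  \<open>\<pi> a\<close> is the bounded extension of left multiplication by \<open>a\<close>. The cyclic vector is
  \<open>\<eta> \<one>\<close>. The values of \<open>\<eta>\<close> and \<open>\<pi>\<close> outside the carrier are irrelevant.\<close>

definition gns_representation ::
    "'a cstar \<Rightarrow> ('a \<Rightarrow> complex) \<Rightarrow> ('a \<Rightarrow> 'h::complex_hilbert_space) \<Rightarrow>
     ('a \<Rightarrow> 'h \<Rightarrow> 'h) \<Rightarrow> bool" where
  "gns_representation A \<phi> \<eta> \<pi> \<longleftrightarrow>
     (\<forall>a\<in>carrier A. \<forall>b\<in>carrier A. \<eta> (a \<oplus>\<^bsub>A\<^esub> b) = \<eta> a + \<eta> b) \<and>
     (\<forall>a\<in>carrier A. \<forall>c. \<eta> (scale A c a) = c *\<^sub>C \<eta> a) \<and>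
     (\<forall>a\<in>carrier A. \<forall>b\<in>carrier A. cinner (\<eta> a) (\<eta> b) = \<phi> (star A b \<otimes>\<^bsub>A\<^esub> a)) \<and>
     closure (\<eta> ` carrier A) = UNIV \<and>
     (\<forall>a\<in>carrier A. \<pi> a \<in> bounded_ops \<and>
        (\<forall>b\<in>carrier A. \<pi> a (\<eta> b) = \<eta> (a \<otimes>\<^bsub>A\<^esub> b)))"


section \<open>The infinite tensor product of copies of $\mathbb{C}^2$\<close>

text \<open>$\mathbb{C}^2$ is the algebra of functions \<open>bool \<Rightarrow> complex\<close>, and the tensor product of
  copies of it indexed by a finite set \<open>F\<close> is the algebra of functions on the finite set of
  points \<open>F \<rightarrow>\<^sub>E UNIV\<close>, with pointwise operations and the maximum norm. Its elements are encoded
  as functions on \<open>'k \<Rightarrow> bool\<close> that vanish at all other arguments.\<close>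

definition points :: "'k set \<Rightarrow> ('k \<Rightarrow> bool) set" where
  "points F = F \<rightarrow>\<^sub>E UNIV"

definition fin_tensor :: "'k set \<Rightarrow> (('k \<Rightarrow> bool) \<Rightarrow> complex) cstar" where
  "fin_tensor F =
     \<lparr> carrier = {a. \<forall>x. x \<notin> points F \<longrightarrow> a x = 0},
       monoid.mult = (\<lambda>a b x. a x * b x),
       one = indicator (points F),
       zero = (\<lambda>_. 0),
       add = (\<lambda>a b x. a x + b x),
       scale = (\<lambda>c a x. c * a x),
       star = (\<lambda>a x. cnj (a x)),
       cnorm = (\<lambda>a. MAX x\<in>points F. cmod (a x)) \<rparr>"

definition elem_tensor ::
    "'k set \<Rightarrow> ('k \<Rightarrow> bool \<Rightarrow> complex) \<Rightarrow> ('k \<Rightarrow> bool) \<Rightarrow> complex" where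
  "elem_tensor F a x = (if x \<in> points F then \<Prod>i\<in>F. a i (x i) else 0)"

text \<open>The connecting map $a \mapsto a \otimes 1_{G \setminus F}$ for $F \subseteq G$.\<close>

definition tensor_embed ::
    "'k set \<Rightarrow> 'k set \<Rightarrow> (('k \<Rightarrow> bool) \<Rightarrow> complex) \<Rightarrow> ('k \<Rightarrow> bool) \<Rightarrow> complex" where
  "tensor_embed F G a x = (if x \<in> points G then a (restrict x F) else 0)"

definition infinite_tensor ::
    "'k set \<Rightarrow> 'a cstar \<Rightarrow> ('k set \<Rightarrow> (('k \<Rightarrow> bool) \<Rightarrow> complex) \<Rightarrow> 'a) \<Rightarrow> bool" where
  "infinite_tensor K A \<iota> \<longleftrightarrow>
     cstar_inductive_limit {F. finite F \<and> F \<subseteq> K} fin_tensor tensor_embed A \<iota>"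

definition tau :: "(bool \<Rightarrow> complex) \<Rightarrow> complex" where
  "tau a = (a False + a True) / 2"

definition product_state ::
    "'k set \<Rightarrow> 'a cstar \<Rightarrow> ('k set \<Rightarrow> (('k \<Rightarrow> bool) \<Rightarrow> complex) \<Rightarrow> 'a) \<Rightarrow>
     ('a \<Rightarrow> complex) \<Rightarrow> bool" where
  "product_state K A \<iota> \<phi> \<longleftrightarrow>
     cstar_state A \<phi> \<and>
     (\<forall>F a. finite F \<and> F \<subseteq> K \<longrightarrow> \<phi> (\<iota> F (elem_tensor F a)) = (\<Prod>i\<in>F. tau (a i)))"

text \<open>The following lemmas confirm that \<open>fin_tensor F\<close> with \<open>elem_tensor F\<close> is the tensor
  product: elementary tensors are multilinear, the products of standard basis vectors form a basis
  (the point masses), and operations and connecting maps are the expected ones on elementary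
  tensors.\<close>

lemma elem_tensor_add:
  assumes "finite F" "i \<in> F"
  shows "elem_tensor F (a(i := \<lambda>b. u b + v b)) =
         (\<lambda>x. elem_tensor F (a(i := u)) x + elem_tensor F (a(i := v)) x)"
  by (simp add: elem_tensor_def fun_eq_iff prod.remove[OF assms] algebra_simps)

lemma elem_tensor_scale:
  assumes "finite F" "i \<in> F"
  shows "elem_tensor F (a(i := \<lambda>b. c * u b)) = scale (fin_tensor F) c (elem_tensor F (a(i := u)))"
  by (simp add: elem_tensor_def fin_tensor_def fun_eq_iff prod.remove[OF assms] algebra_simps)

lemma elem_tensor_basis:
  assumes "finite F" "y \<in> points F"
  shows "elem_tensor F (\<lambda>i. indicator {y i}) = indicator {y}"
proof
  fix x
  show "elem_tensor F (\<lambda>i. indicator {y i}) x = indicator {y} x"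
  proof (cases "x \<in> points F \<and> x \<noteq> y")
    case True
    then obtain i where i: "i \<in> F" "x i \<noteq> y i"
      using assms(2) PiE_ext[of x F "\<lambda>_. UNIV" y] unfolding points_def by blast
    then have "(\<Prod>i\<in>F. indicator {y i} (x i)) = (0::complex)"
      by (intro prod_zero[OF assms(1)] bexI[of _ i]) simp_all
    with True show ?thesis
      by (simp add: elem_tensor_def)
  next
    case False
    then show ?thesis
      using assms(2) by (cases "x = y") (simp_all add: elem_tensor_def)
  qed
qed

lemma elem_tensor_mult:
  "elem_tensor F a \<otimes>\<^bsub>fin_tensor F\<^esub> elem_tensor F b = elem_tensor F (\<lambda>i x. a i x * b i x)"
  by (auto simp: elem_tensor_def fin_tensor_def fun_eq_iff prod.distrib)

lemma elem_tensor_star: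
  "star (fin_tensor F) (elem_tensor F a) = elem_tensor F (\<lambda>i x. cnj (a i x))"
  by (auto simp: elem_tensor_def fin_tensor_def fun_eq_iff)

lemma elem_tensor_one: "\<one>\<^bsub>fin_tensor F\<^esub> = elem_tensor F (\<lambda>_ _. 1)"
  by (auto simp: elem_tensor_def fin_tensor_def fun_eq_iff indicator_def)

lemma restrict_in_points: "F \<subseteq> G \<Longrightarrow> x \<in> points G \<Longrightarrow> restrict x F \<in> points F"
  by (auto simp: points_def)

lemma tensor_embed_elem_tensor:
  assumes "finite G" "F \<subseteq> G"
  shows "tensor_embed F G (elem_tensor F a) = elem_tensor G (\<lambda>i. if i \<in> F then a i else (\<lambda>_. 1))"
proof
  fix x
  show "tensor_embed F G (elem_tensor F a) x =
      elem_tensor G (\<lambda>i. if i \<in> F then a i else (\<lambda>_. 1)) x"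
  proof (cases "x \<in> points G")
    case True
    have "(\<Prod>i\<in>F. a i (restrict x F i)) = (\<Prod>i\<in>G. (if i \<in> F then a i else (\<lambda>_. 1)) (x i))"
      by (rule prod.mono_neutral_cong_left[OF assms]) simp_all
    then show ?thesis
      using True restrict_in_points[OF assms(2) True]
      by (simp only: tensor_embed_def elem_tensor_def if_True)
  qed (simp add: tensor_embed_def elem_tensor_def)
qed

lemma finite_points: "finite F \<Longrightarrow> finite (points F)"
  by (simp add: points_def finite_PiE)

lemma points_nonempty: "points F \<noteq> {}"
  by (simp add: points_def PiE_eq_empty_iff)

lemma fin_tensor_ring: "ring (fin_tensor F)"
proof (rule ringI)
  show "abelian_group (fin_tensor F)"
  proof (rule abelian_groupI)
    fix x assume "x \<in> carrier (fin_tensor F)"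
    then show "\<exists>y\<in>carrier (fin_tensor F). y \<oplus>\<^bsub>fin_tensor F\<^esub> x = \<zero>\<^bsub>fin_tensor F\<^esub>"
      by (intro bexI[of _ "\<lambda>t. - x t"]) (auto simp: fin_tensor_def)
  qed (auto simp: fin_tensor_def fun_eq_iff)
  show "monoid (fin_tensor F)"
    by (rule monoidI) (auto simp: fin_tensor_def fun_eq_iff indicator_def)
qed (auto simp: fin_tensor_def fun_eq_iff algebra_simps)

lemma fin_tensor_minus:
  assumes "a \<in> carrier (fin_tensor F)" "b \<in> carrier (fin_tensor F)"
  shows "a \<ominus>\<^bsub>fin_tensor F\<^esub> b = (\<lambda>x. a x - b x)"
proof -
  interpret ring "fin_tensor F" by (rule fin_tensor_ring)
  have "(\<lambda>x. - b x) \<in> carrier (fin_tensor F)" "(\<lambda>x. - b x) \<oplus>\<^bsub>fin_tensor F\<^esub> b = \<zero>\<^bsub>fin_tensor F\<^esub>"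
    using assms(2) by (auto simp: fin_tensor_def)
  then have "\<ominus>\<^bsub>fin_tensor F\<^esub> b = (\<lambda>x. - b x)"
    using assms(2) minus_equality by blast
  then show ?thesis
    by (simp add: a_minus_def) (simp add: fin_tensor_def)
qed

lemma fin_tensor_cnorm_le_iff:
  "finite F \<Longrightarrow> cnorm (fin_tensor F) a \<le> r \<longleftrightarrow> (\<forall>x\<in>points F. cmod (a x) \<le> r)"
  by (simp add: fin_tensor_def finite_points points_nonempty)

lemma fin_tensor_cnorm_ge:
  "finite F \<Longrightarrow> x \<in> points F \<Longrightarrow> cmod (a x) \<le> cnorm (fin_tensor F) a"
  using fin_tensor_cnorm_le_iff by blast

lemma fin_tensor_cnorm_attained:
  assumes "finite F"
  obtains x where "x \<in> points F" "cnorm (fin_tensor F) a = cmod (a x)"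
proof -
  have "Max ((\<lambda>x. cmod (a x)) ` points F) \<in> (\<lambda>x. cmod (a x)) ` points F"
    using assms by (intro Max_in) (simp_all add: finite_points points_nonempty)
  then show ?thesis using that by (auto simp: fin_tensor_def)
qed

lemma fin_tensor_cstar_algebra:
  assumes F: "finite F"
  shows "cstar_algebra (fin_tensor F)"
proof -
  interpret ring "fin_tensor F" by (rule fin_tensor_ring)
  note le = fin_tensor_cnorm_le_iff[OF F] and ge = fin_tensor_cnorm_ge[OF F]
  show ?thesis
  proof (unfold_locales, goal_cases)
    case (13 x) then show ?case
      by (metis F fin_tensor_cnorm_attained norm_ge_zero)
  next
    case (14 x)
    have "x = \<zero>\<^bsub>fin_tensor F\<^esub>" if 0: "cnorm (fin_tensor F) x = 0"
    proof
      fix t show "x t = \<zero>\<^bsub>fin_tensor F\<^esub> t"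
        using 14 ge[of t x] 0 by (cases "t \<in> points F") (auto simp: fin_tensor_def)
    qed
    moreover have "cnorm (fin_tensor F) \<zero>\<^bsub>fin_tensor F\<^esub> = 0"
      using fin_tensor_cnorm_attained[OF F, of "\<zero>\<^bsub>fin_tensor F\<^esub>"]
      by (metis (no_types, lifting) fin_tensor_def norm_zero ring_record_simps(11))
    ultimately show ?case by blast
  next
    case (15 x y)
    show ?case unfolding le
    proof
      fix t assume "t \<in> points F"
      then show "cmod ((x \<oplus>\<^bsub>fin_tensor F\<^esub> y) t) \<le> cnorm (fin_tensor F) x + cnorm (fin_tensor F) y"
        using ge[of t x] ge[of t y] norm_triangle_ineq[of "x t" "y t"]
        by (simp add: fin_tensor_def)
    qed
  next
    case (16 x c)
    obtain s where s: "s \<in> points F" "cnorm (fin_tensor F) x = cmod (x s)"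
      using fin_tensor_cnorm_attained[OF F] .
    show ?case
    proof (rule antisym)
      show "cnorm (fin_tensor F) (scale (fin_tensor F) c x) \<le> cmod c * cnorm (fin_tensor F) x"
        unfolding le using ge[of _ x] by (auto simp: norm_mult fin_tensor_def intro!: mult_left_mono)
      show "cmod c * cnorm (fin_tensor F) x \<le> cnorm (fin_tensor F) (scale (fin_tensor F) c x)"
        using ge[OF s(1), of "scale (fin_tensor F) c x"] s(2)
        by (simp add: norm_mult fin_tensor_def)
    qed
  next
    case (17 x y)
    show ?case unfolding le
    proof
      fix t assume "t \<in> points F"
      then show "cmod ((x \<otimes>\<^bsub>fin_tensor F\<^esub> y) t) \<le> cnorm (fin_tensor F) x * cnorm (fin_tensor F) y"
        using mult_mono[OF ge[of t x] ge[of t y]] order_trans[OF norm_ge_zero ge[of t x]]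
        by (simp add: fin_tensor_def norm_mult)
    qed
  next
    case (18 x)
    obtain s where s: "s \<in> points F" "cnorm (fin_tensor F) x = cmod (x s)"
      using fin_tensor_cnorm_attained[OF F] .
    have val: "cmod ((star (fin_tensor F) x \<otimes>\<^bsub>fin_tensor F\<^esub> x) t) = (cmod (x t))\<^sup>2" for t
      by (simp add: fin_tensor_def norm_mult power2_eq_square)
    show ?case
    proof (rule antisym)
      show "cnorm (fin_tensor F) (star (fin_tensor F) x \<otimes>\<^bsub>fin_tensor F\<^esub> x)
          \<le> (cnorm (fin_tensor F) x)\<^sup>2"
        unfolding le val using ge[of _ x] by (simp add: power_mono)
      show "(cnorm (fin_tensor F) x)\<^sup>2
          \<le> cnorm (fin_tensor F) (star (fin_tensor F) x \<otimes>\<^bsub>fin_tensor F\<^esub> x)"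
        using ge[OF s(1), of "star (fin_tensor F) x \<otimes>\<^bsub>fin_tensor F\<^esub> x"] s(2) by (simp add: val)
    qed
  next
    case (19 X)
    have diff: "X m \<ominus>\<^bsub>fin_tensor F\<^esub> X n = (\<lambda>t. X m t - X n t)" for m n
      by (rule fin_tensor_minus) (use 19 in auto)
    have "convergent (\<lambda>n. X n t)" if t: "t \<in> points F" for t
    proof (rule Cauchy_convergent, rule CauchyI)
      fix e :: real assume "e > 0"
      then obtain N where N: "\<And>m n. m \<ge> N \<Longrightarrow> n \<ge> N \<Longrightarrow> cnorm (fin_tensor F) (X m \<ominus>\<^bsub>fin_tensor F\<^esub> X n) < e"
        using 19 by blast
      have "cmod (X m t - X n t) < e" if "m \<ge> N" "n \<ge> N" for m n
        using N[OF that] ge[OF t, of "X m \<ominus>\<^bsub>fin_tensor F\<^esub> X n"] by (simp add: diff)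
      then show "\<exists>M. \<forall>m\<ge>M. \<forall>n\<ge>M. cmod (X m t - X n t) < e" by blast
    qed
    then obtain l where l: "\<And>t. t \<in> points F \<Longrightarrow> (\<lambda>n. X n t) \<longlonglongrightarrow> l t"
      unfolding convergent_def by metis
    define x where "x t = (if t \<in> points F then l t else 0)" for t
    have x: "x \<in> carrier (fin_tensor F)" by (simp add: x_def fin_tensor_def)
    have "(\<lambda>n. cnorm (fin_tensor F) (X n \<ominus>\<^bsub>fin_tensor F\<^esub> x)) \<longlonglongrightarrow> 0"
    proof (rule LIMSEQ_I)
      fix e :: real assume e: "e > 0"
      have "\<forall>t\<in>points F. \<forall>\<^sub>F n in sequentially. cmod (X n t - x t) < e"
        using l tendstoD[OF l e] by (auto simp: x_def dist_norm)
      then have "\<forall>\<^sub>F n in sequentially. \<forall>t\<in>points F. cmod (X n t - x t) < e"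
        by (simp add: eventually_ball_finite_distrib finite_points F)
      moreover have "norm (cnorm (fin_tensor F) (X n \<ominus>\<^bsub>fin_tensor F\<^esub> x) - 0) < e"
        if "\<forall>t\<in>points F. cmod (X n t - x t) < e" for n
      proof -
        have "X n \<ominus>\<^bsub>fin_tensor F\<^esub> x = (\<lambda>t. X n t - x t)"
          by (rule fin_tensor_minus) (use 19 x in auto)
        then obtain s where "s \<in> points F"
            "cnorm (fin_tensor F) (X n \<ominus>\<^bsub>fin_tensor F\<^esub> x) = cmod (X n s - x s)"
          using fin_tensor_cnorm_attained[OF F, of "X n \<ominus>\<^bsub>fin_tensor F\<^esub> x"] by metis
        then show ?thesis using that by simp
      qed
      ultimately show "\<exists>N. \<forall>n\<ge>N. norm (cnorm (fin_tensor F) (X n \<ominus>\<^bsub>fin_tensor F\<^esub> x) - 0) < e"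
        by (auto simp: eventually_sequentially)
    qed
    with x show ?case by blast
  qed (simp_all add: fin_tensor_def algebra_simps)
qed

lemma fin_tensor_system:
  "cstar_system {F. finite F \<and> F \<subseteq> K} fin_tensor tensor_embed"
proof -
  have dir: "\<exists>H\<in>{F. finite F \<and> F \<subseteq> K}. F \<subseteq> H \<and> G \<subseteq> H"
    if "F \<in> {F. finite F \<and> F \<subseteq> K}" "G \<in> {F. finite F \<and> F \<subseteq> K}" for F G
    by (rule bexI[of _ "F \<union> G"]) (use that in auto)
  have hom: "cstar_hom (fin_tensor F) (fin_tensor G) (tensor_embed F G)" if "F \<subseteq> G" for F G :: "'a set"
    using restrict_in_points[OF that]
    by (auto simp: cstar_hom_def ring_hom_def fin_tensor_def tensor_embed_def fun_eq_iff indicator_def)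
  have refl: "tensor_embed F F a = a" if "a \<in> carrier (fin_tensor F)" for F :: "'a set" and a
  proof
    fix x
    show "tensor_embed F F a x = a x"
      using that by (auto simp: tensor_embed_def fin_tensor_def points_def PiE_restrict)
  qed
  have trans: "tensor_embed G H (tensor_embed F G a) = tensor_embed F H a"
    if "F \<subseteq> G" "G \<subseteq> H" for F G H :: "'a set" and a
    using that restrict_in_points[OF that(2)]
    by (auto simp: tensor_embed_def fun_eq_iff Int_absorb1)
  show ?thesis
    unfolding cstar_system_def
  proof (intro conjI ballI impI)
    show "{F. finite F \<and> F \<subseteq> K} \<noteq> {}" by blast
  next
    fix F assume "F \<in> {F. finite F \<and> F \<subseteq> K}"
    then show "cstar_algebra (fin_tensor F)" by (simp add: fin_tensor_cstar_algebra)
  qed (rule dir hom refl trans; assumption)+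
qed

end

theory Submission
  imports Defs "HOL-Library.Countable_Set_Type"
begin

text \<open>With \<open>rad = (1, -1)\<close>, the vectors \<open>b F\<close> given by the tensor products of \<open>rad\<close>
  over finite \<open>F \<subseteq> \<kappa>\<close> form an orthonormal basis of the GNS space, and the self-adjoint
  unitaries \<open>u i\<close> given by \<open>rad\<close> at the coordinate \<open>i\<close> act by \<open>u i (b F) = b (F \<triangle> {i})\<close>
  and generate $\mathcal A_\kappa$. Hence the algebra is abelian and the vacuum \<open>\<Omega> = b {}\<close> is
  separating, so that Bessel's inequality for the vectors \<open>p \<Omega>\<close> yields \<sigma>-finiteness. A minimal
  projection \<open>p\<close> would satisfy \<open>u i \<circ> p = \<plusminus> p\<close> for all \<open>i\<close>, so all coefficients of \<open>p \<Omega>\<close> at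
  \<open>b {i}\<close> would have the same nonzero modulus. Finally, if the reduced algebra were generated by
  an infinite set \<open>S\<close> of fewer than \<open>\<kappa>\<close> projections, some coordinate \<open>i\<close> would not occur in
  the countably supported vectors \<open>s \<Omega>\<close>, \<open>s \<in> S\<close>, and \<open>p \<Omega>\<close>; then the conditional expectation
  onto the remaining coordinates commutes with \<open>S\<close> but not with \<open>u i \<circ> p\<close>.\<close>

subsection \<open>Complex inner products\<close>

lemma cinner_add_right: "cinner x (y + z) = cinner x y + cinner x z"
  for x :: "'h::complex_hilbert_space"
  by (metis cinner_add_left cinner_commute complex_cnj_add)

lemma cinner_scaleC_right: "cinner x (c *\<^sub>C y) = cnj c * cinner x y"
  for x :: "'h::complex_hilbert_space"
  by (metis cinner_commute cinner_scaleC_left complex_cnj_mult)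

lemma cinner_scaleR_left: "cinner (r *\<^sub>R x) y = of_real r * cinner x y"
  for x :: "'h::complex_hilbert_space"
  by (metis cinner_scaleC_left scaleC_of_real)

lemma cinner_scaleR_right: "cinner x (r *\<^sub>R y) = of_real r * cinner x y"
  for x :: "'h::complex_hilbert_space"
  by (metis cinner_scaleC_right complex_cnj_complex_of_real scaleC_of_real)

lemma cinner_zero [simp]: "cinner 0 y = 0" "cinner x 0 = 0"
  for x :: "'h::complex_hilbert_space"
  using cinner_scaleR_left[of 0] cinner_scaleR_right[of _ 0] by simp_all

lemma cinner_minus [simp]: "cinner (- x) y = - cinner x y" "cinner x (- y) = - cinner x y"
  for x :: "'h::complex_hilbert_space"
  using cinner_scaleR_left[of "-1"] cinner_scaleR_right[of _ "-1"] by simp_all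

lemma cinner_diff_left: "cinner (x - y) z = cinner x z - cinner y z"
  for x :: "'h::complex_hilbert_space"
  using cinner_add_left[of x "- y"] by simp

lemma cinner_diff_right: "cinner x (y - z) = cinner x y - cinner x z"
  for x :: "'h::complex_hilbert_space"
  using cinner_add_right[of x y "- z"] by simp

lemmas cinner_simps = cinner_add_left cinner_add_right cinner_diff_left cinner_diff_right
  cinner_scaleC_left cinner_scaleC_right cinner_scaleR_left cinner_scaleR_right

lemma cinner_sum_left: "cinner (\<Sum>i\<in>I. f i) y = (\<Sum>i\<in>I. cinner (f i) y)"
  for y :: "'h::complex_hilbert_space"
  by (induction I rule: infinite_finite_induct) (simp_all add: cinner_simps)

lemma cinner_sum_right: "cinner y (\<Sum>i\<in>I. f i) = (\<Sum>i\<in>I. cinner y (f i))"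
  for y :: "'h::complex_hilbert_space"
  by (induction I rule: infinite_finite_induct) (simp_all add: cinner_simps)

lemma cinner_self: "cinner x x = of_real ((norm x)\<^sup>2)"
  for x :: "'h::complex_hilbert_space"
proof (rule complex_eqI)
  show "Im (cinner x x) = Im (of_real ((norm x)\<^sup>2))"
    using arg_cong[OF cinner_commute[of x x], of Im] by simp
qed (simp add: power2_norm_eq_inner inner_eq_Re_cinner)

lemma cinner_self_eq_0 [simp]: "cinner x x = 0 \<longleftrightarrow> x = 0"
  for x :: "'h::complex_hilbert_space"
  by (simp add: cinner_self)

lemma cinner_eqI:
  fixes x y :: "'h::complex_hilbert_space"
  assumes "\<And>z. cinner x z = cinner y z"
  shows "x = y"
proof -
  have "cinner (x - y) (x - y) = 0"
    using assms by (simp add: cinner_diff_left)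
  then show ?thesis by simp
qed

lemma cinner_eq_0_commute: "cinner x y = 0 \<longleftrightarrow> cinner y x = 0"
  for x :: "'h::complex_hilbert_space"
  by (metis cinner_commute complex_cnj_zero)

lemma scaleC_one [simp]: "1 *\<^sub>C x = x"
  for x :: "'h::complex_hilbert_space"
  using scaleC_of_real[of 1 x] by simp

lemma scaleC_zero [simp]: "0 *\<^sub>C x = 0" "c *\<^sub>C 0 = (0::'h)"
  for x :: "'h::complex_hilbert_space"
  using scaleC_of_real[of 0 x] scaleC_add_right[of c 0 "0 :: 'h"] by simp_all

lemma norm_scaleC: "norm (c *\<^sub>C x) = cmod c * norm x"
  for x :: "'h::complex_hilbert_space"
proof -
  have "complex_of_real ((norm (c *\<^sub>C x))\<^sup>2) = of_real ((cmod c * norm x)\<^sup>2)"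
    unfolding power_mult_distrib of_real_mult complex_norm_square cinner_self[symmetric]
    by (simp add: cinner_simps)
  then have "(norm (c *\<^sub>C x))\<^sup>2 = (cmod c * norm x)\<^sup>2"
    using of_real_eq_iff by blast
  then show ?thesis by (simp add: power2_eq_iff_nonneg)
qed

lemma norm_cinner_le: "cmod (cinner x y) \<le> norm x * norm y"
  for x :: "'h::complex_hilbert_space"
proof (cases "cinner x y = 0")
  case False
  \<comment> \<open>A phase of modulus 1 that rotates \<open>cinner x y\<close> to a nonnegative
    real, so that the real Cauchy-Schwarz inequality applies to the rotated vector.\<close>
  define c where "c = cnj (cinner x y) / cmod (cinner x y)"
  have "cmod c = 1" "c * cinner x y = cmod (cinner x y)"
    using False complex_norm_square[of "cinner x y"]
    by (simp_all add: c_def norm_divide power2_eq_square) (simp add: field_simps)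
  then have "cmod (cinner x y) = inner (c *\<^sub>C x) y"
    by (simp add: inner_eq_Re_cinner cinner_simps)
  also have "\<dots> \<le> norm (c *\<^sub>C x) * norm y"
    by (rule norm_cauchy_schwarz)
  finally show ?thesis by (simp add: norm_scaleC \<open>cmod c = 1\<close>)
qed simp

lemma bounded_linear_cinner_left: "bounded_linear (\<lambda>x. cinner x y)"
  for y :: "'h::complex_hilbert_space"
  by (rule bounded_linear_intro[of _ "norm y"])
     (simp_all add: cinner_simps norm_cinner_le scaleR_conv_of_real)

lemma closed_cinner_zero: "closed {y. cinner y x = 0}"
  for x :: "'h::complex_hilbert_space"
  by (intro closed_Collect_eq continuous_on_const
      linear_continuous_on[OF bounded_linear_cinner_left])

section \<open>Closure properties of bounded complex linear operators\<close>

lemma bounded_opsI: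
  fixes T :: "'h::complex_hilbert_space \<Rightarrow> 'h"
  assumes "\<And>x y. T (x + y) = T x + T y" "\<And>c x. T (c *\<^sub>C x) = c *\<^sub>C T x"
    and "\<And>x. norm (T x) \<le> norm x * B"
  shows "T \<in> bounded_ops"
  unfolding bounded_ops_def
  using assms by (auto intro!: bounded_linear_intro[of T B] simp flip: scaleC_of_real)

lemma bounded_ops_linear:
  assumes "T \<in> bounded_ops"
  shows "bounded_linear T" "T (c *\<^sub>C x) = c *\<^sub>C T x" "T (x + y) = T x + T y" "T (x - y) = T x - T y"
    "T 0 = 0" "T (r *\<^sub>R x) = r *\<^sub>R T x"
  using assms linear_simps[of T] by (auto simp: bounded_ops_def)

lemma id_bounded_ops [simp]: "id \<in> bounded_ops"
  by (simp add: bounded_ops_def id_def)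

lemma zero_bounded_ops [simp]: "(\<lambda>_. 0) \<in> bounded_ops"
  by (simp add: bounded_ops_def)

lemma comp_bounded_ops: "S \<in> bounded_ops \<Longrightarrow> T \<in> bounded_ops \<Longrightarrow> S \<circ> T \<in> bounded_ops"
  by (auto simp: bounded_ops_def o_def intro: bounded_linear_compose)

lemma add_bounded_ops: "S \<in> bounded_ops \<Longrightarrow> T \<in> bounded_ops \<Longrightarrow> (\<lambda>x. S x + T x) \<in> bounded_ops"
  by (auto simp: bounded_ops_def scaleC_add_right intro: bounded_linear_add)

lemma scaleC_bounded_ops:
  assumes "T \<in> bounded_ops"
  shows "(\<lambda>x. z *\<^sub>C T x) \<in> bounded_ops"
proof -
  obtain B where "\<And>x. norm (T x) \<le> norm x * B"
    using bounded_linear.bounded[OF bounded_ops_linear(1)[OF assms]] by blast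
  then have "norm (z *\<^sub>C T x) \<le> norm x * (cmod z * B)" for x
    using mult_left_mono[of "norm (T x)" "norm x * B" "cmod z"] by (simp add: norm_scaleC mult_ac)
  then show ?thesis
    by (intro bounded_opsI[of _ "cmod z * B"])
      (simp_all add: bounded_ops_linear[OF assms] scaleC_add_right scaleC_scaleC mult.commute[of z])
qed

lemma scaleR_bounded_ops: "T \<in> bounded_ops \<Longrightarrow> (\<lambda>x. r *\<^sub>R T x) \<in> bounded_ops"
  using scaleC_bounded_ops[of T "of_real r"] by (simp add: scaleC_of_real)

lemma diff_bounded_ops: "S \<in> bounded_ops \<Longrightarrow> T \<in> bounded_ops \<Longrightarrow> (\<lambda>x. S x - T x) \<in> bounded_ops"
  using add_bounded_ops[OF _ scaleR_bounded_ops[of T "-1"], of S] by simp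

subsection \<open>Orthogonal projections and adjoints\<close>

text \<open>The parallelogram law makes a minimizing sequence Cauchy. Closure under midpoints is the
  only convexity that this needs.\<close>

lemma nearest_point_exists:
  fixes V :: "'h::{real_inner, complete_space} set"
  assumes V: "closed V" "V \<noteq> {}" "\<And>x y. x \<in> V \<Longrightarrow> y \<in> V \<Longrightarrow> (1/2) *\<^sub>R (x + y) \<in> V"
  obtains v where "v \<in> V" "\<And>w. w \<in> V \<Longrightarrow> norm (x - v) \<le> norm (x - w)"
proof -
  define d where "d = (INF w\<in>V. norm (x - w))"
  have bdd: "bdd_below ((\<lambda>w. norm (x - w)) ` V)"
    by (rule bdd_belowI2[of _ 0]) simp
  have d: "d \<le> norm (x - w)" if "w \<in> V" for w
    unfolding d_def using bdd that by (rule cINF_lower)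
  have d0: "d \<ge> 0"
    unfolding d_def using V(2) by (intro cINF_greatest) auto
  have "\<exists>w\<in>V. norm (x - w) < d + 1 / Suc n" for n
    using cINF_less_iff[OF V(2) bdd, of "d + 1 / Suc n"] by (simp add: d_def)
  then obtain v where v: "\<And>n. v n \<in> V" "\<And>n. norm (x - v n) < d + 1 / Suc n"
    by metis
  have lim: "(\<lambda>n. norm (x - v n)) \<longlonglongrightarrow> d"
  proof (rule tendsto_sandwich[of "\<lambda>_. d" _ _ "\<lambda>n. d + 1 / Suc n"])
    show "(\<lambda>n. d + 1 / real (Suc n)) \<longlonglongrightarrow> d"
      using tendsto_add[OF tendsto_const[of d] LIMSEQ_inverse_real_of_nat] by (simp add: inverse_eq_divide)
  qed (use v d in \<open>auto intro!: always_eventually less_imp_le\<close>)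
  \<comment> \<open>The parallelogram law for \<open>x - v m\<close> and \<open>x - v n\<close>; the
    midpoint of \<open>v m\<close> and \<open>v n\<close> is again in \<open>V\<close>, hence at
    distance at least \<open>d\<close> from \<open>x\<close>.\<close>
  have par: "(norm (v m - v n))\<^sup>2 \<le> 2 * ((norm (x - v m))\<^sup>2 - d\<^sup>2) + 2 * ((norm (x - v n))\<^sup>2 - d\<^sup>2)"
    for m n
  proof -
    have "(norm (v m - v n))\<^sup>2 =
        2 * (norm (x - v m))\<^sup>2 + 2 * (norm (x - v n))\<^sup>2 - 4 * (norm (x - (1/2) *\<^sub>R (v m + v n)))\<^sup>2"
      by (simp add: power2_norm_eq_inner inner_simps inner_commute algebra_simps)
    moreover have "d\<^sup>2 \<le> (norm (x - (1/2) *\<^sub>R (v m + v n)))\<^sup>2"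
      using d0 d[OF V(3)[OF v(1)[of m] v(1)[of n]]] by (rule power_mono[rotated])
    ultimately show ?thesis by simp
  qed
  have "Cauchy v"
  proof (rule CauchyI)
    fix e :: real assume e: "e > 0"
    have "(\<lambda>n. (norm (x - v n))\<^sup>2 - d\<^sup>2) \<longlonglongrightarrow> d\<^sup>2 - d\<^sup>2"
      by (intro tendsto_intros lim)
    then have "\<forall>\<^sub>F n in sequentially. (norm (x - v n))\<^sup>2 - d\<^sup>2 < e\<^sup>2 / 4"
      using e by (intro order_tendstoD(2)[of _ 0]) simp_all
    then obtain M where M: "\<And>n. n \<ge> M \<Longrightarrow> (norm (x - v n))\<^sup>2 - d\<^sup>2 < e\<^sup>2 / 4"
      by (auto simp: eventually_sequentially)
    have "norm (v m - v n) < e" if "m \<ge> M" "n \<ge> M" for m n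
      using par[of m n] M[OF that(1)] M[OF that(2)] e
      by (intro power2_less_imp_less[of _ e]) auto
    then show "\<exists>M. \<forall>m\<ge>M. \<forall>n\<ge>M. norm (v m - v n) < e" by blast
  qed
  then obtain l where l: "v \<longlonglongrightarrow> l"
    using Cauchy_convergent convergent_def by blast
  have "l \<in> V"
    using closed_sequentially[OF V(1) v(1) l] .
  moreover have "norm (x - l) = d"
    by (rule LIMSEQ_unique[OF _ lim]) (intro tendsto_intros l)
  ultimately show ?thesis
    using that d by blast
qed

text \<open>\<open>E x\<close> is the point of \<open>V\<close> nearest to \<open>x\<close>. The
  residual is orthogonal to \<open>V\<close>, since a component along some \<open>w\<close> in
  \<open>V\<close> could be removed to shorten the distance.\<close>

lemma closed_subspace_projection:
  fixes V :: "'h::complex_hilbert_space set"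
  assumes V: "closed V" "0 \<in> V" "\<And>x y. x \<in> V \<Longrightarrow> y \<in> V \<Longrightarrow> x + y \<in> V"
    "\<And>c x. x \<in> V \<Longrightarrow> c *\<^sub>C x \<in> V"
  obtains E where "projection E" "\<And>x. E x \<in> V" "\<And>x v. v \<in> V \<Longrightarrow> cinner (x - E x) v = 0"
proof -
  have "\<exists>v. v \<in> V \<and> (\<forall>w\<in>V. cinner (x - v) w = 0)" for x
  proof -
    have "(1/2) *\<^sub>R (y + z) \<in> V" if "y \<in> V" "z \<in> V" for y z
      using V(3)[OF that] V(4) by (simp flip: scaleC_of_real)
    then obtain v where v: "v \<in> V" "\<And>w. w \<in> V \<Longrightarrow> norm (x - v) \<le> norm (x - w)"
      using nearest_point_exists[OF V(1), of x] V(2) by blast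
    have "cinner (x - v) w = 0" if w: "w \<in> V" for w
    proof (rule ccontr)
      assume ne: "cinner (x - v) w \<noteq> 0"
      then have w0: "norm w \<noteq> 0" by auto
      \<comment> \<open>The Fourier coefficient of the residual along \<open>w\<close>; removing it
        lowers the squared distance by a positive amount.\<close>
      define c where "c = cinner (x - v) w / (norm w)\<^sup>2"
      have "v + c *\<^sub>C w \<in> V" using V v(1) w by blast
      then have "(norm (x - v))\<^sup>2 \<le> (norm (x - v - c *\<^sub>C w))\<^sup>2"
        using v(2) by (simp add: diff_diff_eq)
      moreover have "cinner (x - v - c *\<^sub>C w) (x - v - c *\<^sub>C w) =
          cinner (x - v) (x - v) - of_real ((cmod (cinner (x - v) w))\<^sup>2 / (norm w)\<^sup>2)"
      proof -
        let ?z = "x - v"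
        have "cinner (?z - c *\<^sub>C w) (?z - c *\<^sub>C w) =
            cinner ?z ?z - cnj c * cinner ?z w - c * cinner w ?z + c * cnj c * cinner w w"
          by (simp add: cinner_simps algebra_simps)
        moreover have "c * cinner w ?z = of_real ((cmod (cinner ?z w))\<^sup>2 / (norm w)\<^sup>2)"
          unfolding of_real_divide complex_norm_square c_def
          by (subst cinner_commute) simp
        moreover have "cnj c * cinner ?z w = of_real ((cmod (cinner ?z w))\<^sup>2 / (norm w)\<^sup>2)"
          unfolding of_real_divide complex_norm_square by (simp add: c_def)
        moreover have "c * cnj c * cinner w w = of_real ((cmod (cinner ?z w))\<^sup>2 / (norm w)\<^sup>2)"
          using w0 unfolding of_real_divide complex_norm_square
          by (simp add: c_def cinner_self power2_eq_square)
        ultimately show ?thesis by simp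
      qed
      then have "(norm (x - v - c *\<^sub>C w))\<^sup>2 = (norm (x - v))\<^sup>2 - (cmod (cinner (x - v) w))\<^sup>2 / (norm w)\<^sup>2"
        unfolding cinner_self of_real_diff[symmetric] of_real_eq_iff .
      moreover have "(cmod (cinner (x - v) w))\<^sup>2 / (norm w)\<^sup>2 > 0"
        using ne w0 by simp
      ultimately show False by simp
    qed
    with v(1) show ?thesis by blast
  qed
  then obtain E where E: "\<And>x. E x \<in> V" and orth: "\<And>x w. w \<in> V \<Longrightarrow> cinner (x - E x) w = 0"
    by metis
  \<comment> \<open>The decomposition into a point of \<open>V\<close> and an orthogonal residual is
    unique; idempotence and linearity of \<open>E\<close> are read off from this.\<close>
  have uniq: "E x = v" if "v \<in> V" "\<And>w. w \<in> V \<Longrightarrow> cinner (x - v) w = 0" for x v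
  proof -
    have "v - E x \<in> V"
      using V(3)[OF that(1) V(4)[OF E[of x], of "-1"]]
      by (metis of_real_1 of_real_minus scaleC_of_real scaleR_minus1_left uminus_add_conv_diff add.commute)
    then have "cinner (v - E x) (v - E x) = 0"
      using orth[of "v - E x" x] that(2)[of "v - E x"] by (simp add: cinner_diff_left)
    then show ?thesis by simp
  qed
  have idem: "E x = x" if "x \<in> V" for x
    using uniq that by simp
  have lin: "E (x + y) = E x + E y" for x y
    by (rule uniq) (use V E orth[of _ x] orth[of _ y] in \<open>simp_all add: cinner_simps algebra_simps\<close>)
  have scal: "E (c *\<^sub>C x) = c *\<^sub>C E x" for c x
    by (rule uniq) (use V E orth[of _ x] in \<open>simp_all add: cinner_simps\<close>)
  have Ecin: "cinner (E x) (E y) = cinner x (E y)" for x y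
    using orth[OF E, of x y] by (simp add: cinner_simps)
  have "norm (E x) \<le> norm x * 1" for x
  proof (cases "norm (E x) = 0")
    case False
    have "norm (E x) * norm (E x) = cmod (cinner x (E x))"
      using arg_cong[OF Ecin[of x x], of cmod] by (simp add: cinner_self norm_mult power2_eq_square)
    also have "\<dots> \<le> norm x * norm (E x)" by (rule norm_cinner_le)
    finally show ?thesis using False by simp
  qed simp
  then have "E \<in> bounded_ops"
    using lin scal by (intro bounded_opsI)
  moreover have "is_adjoint E E"
    unfolding is_adjoint_def by (metis Ecin cinner_commute)
  ultimately have "projection E"
    unfolding projection_def using idem E by (simp add: fun_eq_iff)
  then show ?thesis
    using that E orth by blast
qed

text \<open>The kernel of a nonzero \<open>f\<close> has codimension one, so \<open>f\<close> is the
  inner product with a multiple of any nonzero vector orthogonal to it. Such a vector is the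
  residual \<open>z\<close> of a point outside the kernel.\<close>

lemma riesz_representation:
  fixes f :: "'h::complex_hilbert_space \<Rightarrow> complex"
  assumes f: "bounded_linear f" "\<And>c x. f (c *\<^sub>C x) = c * f x"
  obtains y where "\<And>x. f x = cinner x y"
proof (cases "\<forall>x. f x = 0")
  case True
  then show ?thesis using that[of 0] by simp
next
  case False
  then obtain x0 where x0: "f x0 \<noteq> 0" by blast
  have "closed {x. f x = 0}"
    by (intro closed_Collect_eq continuous_on_const linear_continuous_on f(1))
  then obtain E where "\<And>x. E x \<in> {x. f x = 0}"
      "\<And>x v. v \<in> {x. f x = 0} \<Longrightarrow> cinner (x - E x) v = 0"
    by (rule closed_subspace_projection) (auto simp: linear_simps[OF f(1)] f(2))
  then have E: "\<And>x. f (E x) = 0" "\<And>x v. f v = 0 \<Longrightarrow> cinner (x - E x) v = 0"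
    by simp_all
  define z where "z = x0 - E x0"
  have fz: "f z \<noteq> 0" using x0 E(1) by (simp add: z_def linear_simps[OF f(1)])
  then have zz: "cinner z z \<noteq> 0" using linear_simps(3)[OF f(1)] by auto
  have "f x = cinner x ((cnj (f z) / cinner z z) *\<^sub>C z)" for x
  proof -
    have "cinner z (x - (f x / f z) *\<^sub>C z) = 0"
      unfolding z_def by (rule E(2)) (use fz in \<open>simp add: linear_simps[OF f(1)] f(2) z_def\<close>)
    then have "cinner (x - (f x / f z) *\<^sub>C z) z = 0"
      by (metis cinner_commute complex_cnj_zero)
    then have "cinner x z = f x / f z * cinner z z"
      by (simp add: cinner_simps)
    moreover have "cnj (cinner z z) = cinner z z" by (metis cinner_commute)
    ultimately show ?thesis using fz zz by (simp add: cinner_simps)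
  qed
  then show ?thesis using that by blast
qed

text \<open>Riesz representation of \<open>cinner (T x) y\<close> as a functional of
  \<open>x\<close> yields \<open>S y\<close>. The bound comes from Cauchy-Schwarz for the square of
  \<open>norm (S y)\<close>, which equals \<open>cinner y (T (S y))\<close>.\<close>

lemma adjoint_exists:
  fixes T :: "'h::complex_hilbert_space \<Rightarrow> 'h"
  assumes T: "T \<in> bounded_ops"
  obtains S where "S \<in> bounded_ops" "is_adjoint S T" "is_adjoint T S"
proof -
  note bl = bounded_ops_linear[OF T]
  have "\<exists>z. \<forall>x. cinner (T x) y = cinner x z" for y
    using riesz_representation[of "\<lambda>x. cinner (T x) y"]
      bounded_linear_compose[OF bounded_linear_cinner_left bl(1)]
    by (metis bl(2) cinner_scaleC_left)
  then obtain S where S: "\<And>x y. cinner (T x) y = cinner x (S y)" by metis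
  then have S': "cinner (S y) x = cinner y (T x)" for x y
    by (metis cinner_commute)
  obtain B where B: "\<And>x. norm (T x) \<le> norm x * B" "B > 0"
    using bounded_linear.pos_bounded[OF bl(1)] by blast
  have "norm (S y) \<le> norm y * B" for y
  proof (cases "norm (S y) = 0")
    case False
    have "norm (S y) * norm (S y) = cmod (cinner y (T (S y)))"
      using S'[of y "S y"] by (metis cinner_self norm_of_real abs_power2 power2_eq_square of_real_mult)
    also have "\<dots> \<le> norm y * norm (T (S y))" by (rule norm_cinner_le)
    also have "\<dots> \<le> norm y * (norm (S y) * B)" using B by (intro mult_left_mono) auto
    finally show ?thesis using False by (simp add: mult_ac)
  qed (use B in simp)
  moreover have "S (x + y) = S x + S y" "S (c *\<^sub>C x) = c *\<^sub>C S x" for c x y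
    by (rule cinner_eqI; simp add: S' cinner_simps)+
  ultimately have "S \<in> bounded_ops" by (intro bounded_opsI) blast+
  then show ?thesis
    using that S S' by (simp add: is_adjoint_def)
qed

subsection \<open>Projections and commutants\<close>

lemma is_adjoint_sym: "is_adjoint S T \<longleftrightarrow> is_adjoint T S"
  unfolding is_adjoint_def by (metis cinner_commute)

lemma projectionD:
  assumes "projection p"
  shows "p \<in> bounded_ops" "p \<circ> p = p" "p (p x) = p x" "cinner (p x) y = cinner x (p y)"
  using assms by (auto simp: projection_def is_adjoint_def fun_eq_iff)

lemma projection_id [simp]: "projection id"
  by (simp add: projection_def is_adjoint_def)

lemma projection_comp:
  assumes "projection p" "projection q" "p \<circ> q = q \<circ> p"
  shows "projection (p \<circ> q)"
  unfolding projection_def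
proof (intro conjI)
  show "p \<circ> q \<circ> (p \<circ> q) = p \<circ> q"
    using assms(3) projectionD(2)[OF assms(1)] projectionD(2)[OF assms(2)] by (metis comp_assoc)
  show "is_adjoint (p \<circ> q) (p \<circ> q)"
    using assms(3) projectionD(4)[OF assms(1)] projectionD(4)[OF assms(2)]
    by (simp add: is_adjoint_def fun_eq_iff)
qed (use assms in \<open>simp add: comp_bounded_ops projectionD\<close>)

lemma cinner_projection_self:
  "projection p \<Longrightarrow> cinner (p x) x = of_real ((norm (p x))\<^sup>2)"
  by (metis cinner_self projectionD(3,4))

lemma commutant_commute: "T \<in> commutant p S \<Longrightarrow> s \<in> S \<Longrightarrow> T (s x) = s (T x)"
  by (auto simp: commutant_def fun_eq_iff)

lemma commutant_id_iff:
  "T \<in> commutant id C \<longleftrightarrow> T \<in> bounded_ops \<and> (\<forall>s\<in>C. \<forall>x. T (s x) = s (T x))"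
  by (auto simp: commutant_def fun_eq_iff)

lemma commutant_antimono: "S \<subseteq> S' \<Longrightarrow> commutant p S' \<subseteq> commutant p S"
  by (auto simp: commutant_def)

lemma subset_bicommutant:
  assumes "\<And>s. s \<in> S \<Longrightarrow> s \<in> bounded_ops \<and> p \<circ> s \<circ> p = s"
  shows "S \<subseteq> commutant p (commutant p S)"
  using assms by (auto simp: commutant_def)

lemma tricommutant:
  assumes "\<And>s. s \<in> S \<Longrightarrow> s \<in> bounded_ops \<and> p \<circ> s \<circ> p = s"
  shows "commutant p (commutant p (commutant p S)) = commutant p S"
proof
  show "commutant p (commutant p (commutant p S)) \<subseteq> commutant p S"
    using subset_bicommutant[OF assms] by (rule commutant_antimono)
  show "commutant p S \<subseteq> commutant p (commutant p (commutant p S))"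
    by (rule subset_bicommutant) (simp add: commutant_def)
qed

text \<open>Taking adjoints in \<open>T s = s T\<close> shows that the adjoint of \<open>T\<close>
  commutes with the adjoint of \<open>s\<close>, and \<open>S\<close> is closed under
  adjoints.\<close>

lemma adjoint_in_commutant:
  assumes p: "projection p" and S: "\<And>s. s \<in> S \<Longrightarrow> \<exists>t\<in>S. is_adjoint t s"
    and T: "T \<in> commutant p S"
  shows "\<exists>R\<in>commutant p S. is_adjoint R T"
proof -
  obtain R where R: "R \<in> bounded_ops" "is_adjoint R T"
    using adjoint_exists[of T] T by (auto simp: commutant_def)
  then have adj: "cinner (R x) y = cinner x (T y)" for x y
    by (simp add: is_adjoint_def)
  have T': "p (T (p x)) = T x" "s \<in> S \<Longrightarrow> T (s x) = s (T x)" for s x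
    using T by (auto simp: commutant_def fun_eq_iff)
  have "p (R (p x)) = R x" for x
    by (rule cinner_eqI) (simp add: adj projectionD(4)[OF p] T')
  moreover have "R (s x) = s (R x)" if s: "s \<in> S" for s x
  proof (rule cinner_eqI)
    fix y
    obtain t where t: "t \<in> S" "is_adjoint s t"
      using S[OF s] is_adjoint_sym by blast
    then show "cinner (R (s x)) y = cinner (s (R x)) y"
      by (simp add: adj T' is_adjoint_def)
  qed
  ultimately show ?thesis
    using R by (auto simp: commutant_def fun_eq_iff)
qed

text \<open>The triple commutant collapses to the commutant, so the bicommutant equals its own
  bicommutant; adjoints pass through both commutants.\<close>

lemma von_neumann_algebra_bicommutant:
  assumes p: "projection p" and S: "\<And>s. s \<in> S \<Longrightarrow> s \<in> bounded_ops \<and> p \<circ> s \<circ> p = s"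
    and adj: "\<And>s. s \<in> S \<Longrightarrow> \<exists>t\<in>S. is_adjoint t s"
  shows "von_neumann_algebra p (commutant p (commutant p S))"
  unfolding von_neumann_algebra_def
  using p tricommutant[OF S] adjoint_in_commutant[OF p adjoint_in_commutant[OF p adj]]
  by simp

text \<open>Projections are self-adjoint, so the bicommutant is itself one of the algebras
  intersected. Any other contains it, because taking commutants twice is monotone. Generation thus
  becomes a computation with commutants.\<close>

lemma vn_generated_eq_bicommutant:
  assumes p: "projection p" and S: "\<And>s. s \<in> S \<Longrightarrow> projection s \<and> p \<circ> s \<circ> p = s"
  shows "vn_generated p S = commutant p (commutant p S)"
proof
  have *: "\<And>s. s \<in> S \<Longrightarrow> s \<in> bounded_ops \<and> p \<circ> s \<circ> p = s"
    using S by (simp add: projectionD)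
  show "vn_generated p S \<subseteq> commutant p (commutant p S)"
    unfolding vn_generated_def
  proof (rule Inter_lower, rule CollectI, rule conjI)
    show "von_neumann_algebra p (commutant p (commutant p S))"
      using p * by (rule von_neumann_algebra_bicommutant) (use S in \<open>auto simp: projection_def\<close>)
  qed (rule subset_bicommutant[OF *])
  show "commutant p (commutant p S) \<subseteq> vn_generated p S"
    unfolding vn_generated_def
  proof (rule Inter_greatest, elim CollectE conjE)
    fix M assume "von_neumann_algebra p M" "S \<subseteq> M"
    then show "commutant p (commutant p S) \<subseteq> M"
      unfolding von_neumann_algebra_def by (metis commutant_antimono)
  qed
qed

text \<open>Commutativity of \<open>S\<close> puts the bicommutant inside the commutant, and the two
  commute with each other.\<close>

lemma vn_abelian_bicommutant:
  assumes "S \<subseteq> commutant id S"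
  shows "vn_abelian (commutant id (commutant id S))"
    and "commutant id (commutant id S) \<subseteq> commutant id S"
proof -
  show *: "commutant id (commutant id S) \<subseteq> commutant id S"
    using assms by (rule commutant_antimono)
  show "vn_abelian (commutant id (commutant id S))"
    using * unfolding vn_abelian_def by (auto simp: commutant_id_iff fun_eq_iff)
qed

section \<open>Reduction of an abelian von Neumann algebra by one of its projections\<close>

context
  fixes M :: "('h::complex_hilbert_space \<Rightarrow> 'h) set" and p
  assumes M: "von_neumann_algebra id M" "vn_abelian M" and p: "p \<in> M" "projection p"
begin

text \<open>The commutants on \<open>pH\<close> and on \<open>H\<close> are compared in both
  directions. An operator on \<open>pH\<close> commuting with the reduced \<open>S\<close>, extended
  by zero, commutes with \<open>S\<close> on \<open>H\<close>. Conversely \<open>R \<circ> p\<close>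
  lies in the reduced commutant for each \<open>R\<close> in the commutant of
  \<open>M\<close>.\<close>

lemma reduced_in_bicommutant:
  assumes S: "S \<subseteq> M" "M = commutant id (commutant id S)"
  shows "commutant p (commutant p ((\<lambda>T. T \<circ> p) ` S)) = (\<lambda>T. T \<circ> p) ` M"
proof
  have bicomm: "commutant id (commutant id M) = M"
    using M(1) by (simp add: von_neumann_algebra_def)
  have bdd: "T \<in> bounded_ops" if "T \<in> M" for T
    using that bicomm commutant_id_iff by blast
  have comm: "T (p x) = p (T x)" if "T \<in> M" for T x
    using that p(1) M(2) by (metis vn_abelian_def comp_apply)
  note pp = projectionD(3)[OF p(2)]
  show "(\<lambda>T. T \<circ> p) ` M \<subseteq> commutant p (commutant p ((\<lambda>T. T \<circ> p) ` S))"
  proof (rule image_subsetI)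
    fix T assume T: "T \<in> M"
    have "T (p (R x)) = R (T (p x))" if "R \<in> commutant p ((\<lambda>T. T \<circ> p) ` S)" for R x
    proof -
      have R: "p (R (p x)) = R x" "s \<in> S \<Longrightarrow> R (s (p x)) = s (p (R x))" for s x
        using that by (auto simp: commutant_def fun_eq_iff)
      have pR: "p (R x) = R x" "R (p x) = R x" for x
        using R(1)[of x] R(1)[of "p x"] pp by metis+
      have "R (s x) = s (R x)" if "s \<in> S" for s x
        using R(2)[OF that, of x] comm[of s] that S(1) pR by (metis subsetD)
      moreover have "R \<in> bounded_ops"
        using that by (simp add: commutant_def)
      ultimately have "R \<in> commutant id S"
        by (simp add: commutant_id_iff)
      then have "T (R x) = R (T x)" for x
        using T S(2) by (metis commutant_id_iff)
      then show ?thesis by (metis pR comm[OF T])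
    qed
    then show "T \<circ> p \<in> commutant p (commutant p ((\<lambda>T. T \<circ> p) ` S))"
      using T p by (auto simp: commutant_def fun_eq_iff comp_bounded_ops bdd comm pp)
  qed
  show "commutant p (commutant p ((\<lambda>T. T \<circ> p) ` S)) \<subseteq> (\<lambda>T. T \<circ> p) ` M"
  proof
    fix T assume T: "T \<in> commutant p (commutant p ((\<lambda>T. T \<circ> p) ` S))"
    then have Tp: "p (T (p x)) = T x" for x
      by (auto simp: commutant_def fun_eq_iff)
    have pT: "p (T x) = T x" "T (p x) = T x" for x
      using Tp[of x] Tp[of "p x"] pp by metis+
    have "T (R x) = R (T x)" if R: "R \<in> commutant id M" for R x
    proof -
      have RM: "X \<in> M \<Longrightarrow> R (X y) = X (R y)" for X y
        using R by (simp add: commutant_id_iff)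
      have "R \<circ> p \<in> commutant p ((\<lambda>T. T \<circ> p) ` S)"
        using R p S(1) unfolding commutant_id_iff
        by (auto simp: commutant_def fun_eq_iff comp_bounded_ops bdd RM comm pp subsetD)
      then have "T (R (p x)) = R (p (T x))"
        using T by (auto simp: commutant_def fun_eq_iff)
      then show ?thesis
        by (metis RM p(1) pT)
    qed
    then have "T \<in> commutant id (commutant id M)"
      using T by (simp add: commutant_id_iff) (simp add: commutant_def)
    then have "T \<in> M" by (simp add: bicomm)
    moreover have "T = T \<circ> p" by (simp add: fun_eq_iff pT)
    ultimately show "T \<in> (\<lambda>T. T \<circ> p) ` M" by blast
  qed
qed

lemma generating_projections_reduced:
  assumes S: "S \<subseteq> M" "M = commutant id (commutant id S)" "\<And>s. s \<in> S \<Longrightarrow> projection s"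
  shows "generating_projections p ((\<lambda>T. T \<circ> p) ` M) ((\<lambda>T. T \<circ> p) ` S)"
proof -
  have comm: "s \<circ> p = p \<circ> s" if "s \<in> S" for s
    using that p(1) S(1) M(2) unfolding vn_abelian_def by blast
  have "projection (s \<circ> p) \<and> p \<circ> (s \<circ> p) \<circ> p = s \<circ> p" if "s \<in> S" for s
    using projection_comp[OF S(3)[OF that] p(2) comm[OF that]] comm[OF that] projectionD(2)[OF p(2)]
    by (metis comp_assoc)
  then show ?thesis
    unfolding generating_projections_def
    using vn_generated_eq_bicommutant[OF p(2), of "(\<lambda>T. T \<circ> p) ` S"] reduced_in_bicommutant[OF S(1,2)] S(1)
    by auto
qed

text \<open>Turns an arbitrary generating set of the reduced algebra into the commutant form on
  which the lower bound for its cardinality works.\<close>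

lemma generating_projections_reducedD:
  assumes "generating_projections p ((\<lambda>T. T \<circ> p) ` M) S"
  shows "S \<subseteq> M" "\<And>s. s \<in> S \<Longrightarrow> projection s \<and> p \<circ> s = s \<and> s \<circ> p = s"
    and "(\<lambda>T. T \<circ> p) ` M = commutant p (commutant p S)"
proof -
  have bicomm: "commutant id (commutant id M) = M"
    using M(1) by (simp add: von_neumann_algebra_def)
  have comm: "T \<circ> p = p \<circ> T" if "T \<in> M" for T
    using that p(1) M(2) unfolding vn_abelian_def by blast
  have comp: "T \<circ> p \<in> M" if "T \<in> M" for T
  proof -
    have "T \<in> commutant id (commutant id M)" "p \<in> commutant id (commutant id M)"
      using that p(1) bicomm by auto
    then have "T \<circ> p \<in> commutant id (commutant id M)"
      by (simp add: commutant_id_iff comp_bounded_ops)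
    then show ?thesis using bicomm by simp
  qed
  have S: "S \<subseteq> (\<lambda>T. T \<circ> p) ` M" "\<And>s. s \<in> S \<Longrightarrow> projection s"
    using assms unfolding generating_projections_def by auto
  then show SM: "S \<subseteq> M" using comp by blast
  show *: "projection s \<and> p \<circ> s = s \<and> s \<circ> p = s" if s: "s \<in> S" for s
  proof -
    have "s \<circ> p = s"
      using s S(1) projectionD(2)[OF p(2)] by (auto simp: comp_assoc)
    then show ?thesis using comm[of s] SM s S(2) by auto
  qed
  have "vn_generated p S = commutant p (commutant p S)"
    by (rule vn_generated_eq_bicommutant[OF p(2)]) (use * in auto)
  then show "(\<lambda>T. T \<circ> p) ` M = commutant p (commutant p S)"
    using assms unfolding generating_projections_def by simp
qed

end

text \<open>Cardinals are well-ordered, so a generating set of least cardinality exists and the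
  choice operator in \<open>vn_gen_card\<close> picks one. The two bounds then fix its
  cardinality.\<close>

lemma ordIso_vn_gen_card:
  fixes \<kappa> :: "'k rel" and M :: "('h::complex_hilbert_space \<Rightarrow> 'h) set"
  assumes S0: "generating_projections p M S0" "|S0| \<le>o \<kappa>"
    and lower: "\<And>S. generating_projections p M S \<Longrightarrow> \<kappa> \<le>o |S|"
  shows "\<kappa> =o vn_gen_card p M"
proof -
  let ?P = "\<lambda>S. generating_projections p M S \<and> (\<forall>S'. generating_projections p M S' \<longrightarrow> |S| \<le>o |S'| )"
  have "\<exists>r\<in>card_of ` Collect (generating_projections p M).
      \<forall>r'\<in>card_of ` Collect (generating_projections p M). r \<le>o r'"
    by (rule exists_minim_Card_order) (use S0(1) in \<open>auto simp: card_of_Card_order\<close>)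
  then have "\<exists>S. ?P S" by auto
  then have P: "?P (SOME S. ?P S)" by (rule someI_ex)
  then have "|SOME S. ?P S| \<le>o \<kappa>"
    using S0 ordLeq_transitive by blast
  with lower P show ?thesis
    unfolding vn_gen_card_def ordIso_iff_ordLeq by blast
qed

subsection \<open>Orthonormal families\<close>

text \<open>With \<open>y\<close> the orthogonal projection of \<open>x\<close> onto the span of the
  family, the gap between the two sides is the square of \<open>norm (x - y)\<close>.\<close>

lemma bessel_inequality:
  fixes v :: "'i \<Rightarrow> 'h::complex_hilbert_space"
  assumes "finite I" and v: "\<And>i j. i \<in> I \<Longrightarrow> j \<in> I \<Longrightarrow> cinner (v i) (v j) = (if i = j then 1 else 0)"
  shows "(\<Sum>i\<in>I. (cmod (cinner x (v i)))\<^sup>2) \<le> (norm x)\<^sup>2"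
proof -
  define y where "y = (\<Sum>i\<in>I. cinner x (v i) *\<^sub>C v i)"
  define s where "s = (\<Sum>i\<in>I. (cmod (cinner x (v i)))\<^sup>2)"
  have viy: "cinner (v i) y = cnj (cinner x (v i))" if "i \<in> I" for i
  proof -
    have "cinner (v i) y = (\<Sum>j\<in>I. if j = i then cnj (cinner x (v i)) else 0)"
      unfolding y_def cinner_sum_right
      by (rule sum.cong) (use v that in \<open>auto simp: cinner_simps\<close>)
    then show ?thesis using assms(1) that by simp
  qed
  have s: "of_real s = (\<Sum>i\<in>I. cinner x (v i) * cnj (cinner x (v i)))"
    by (simp add: s_def flip: complex_norm_square)
  have yy: "cinner y y = of_real s"
    unfolding s by (subst (1) y_def) (simp add: cinner_sum_left cinner_simps viy)
  have xy: "cinner x y = of_real s"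
    unfolding s by (subst y_def) (simp add: cinner_sum_right cinner_simps mult.commute)
  then have yx: "cinner y x = of_real s"
    by (metis cinner_commute complex_cnj_complex_of_real)
  have "cinner (x - y) (x - y) = of_real ((norm x)\<^sup>2 - s)"
    by (simp add: cinner_simps yy xy yx) (simp add: cinner_self)
  then have "(norm (x - y))\<^sup>2 = (norm x)\<^sup>2 - s"
    unfolding cinner_self of_real_eq_iff .
  then show ?thesis unfolding s_def[symmetric] by (metis diff_ge_0_iff_ge zero_le_power2)
qed

lemma finite_large_coefficients:
  fixes v :: "'i \<Rightarrow> 'h::complex_hilbert_space"
  assumes v: "\<And>i j. i \<in> I \<Longrightarrow> j \<in> I \<Longrightarrow> cinner (v i) (v j) = (if i = j then 1 else 0)"
    and e: "e > 0"
  shows "finite {i\<in>I. e \<le> cmod (cinner x (v i))}"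
proof (rule ccontr)
  assume inf: "infinite {i\<in>I. e \<le> cmod (cinner x (v i))}"
  \<comment> \<open>So many coefficients of modulus at least \<open>e\<close> would exceed the bound
    in Bessel's inequality.\<close>
  obtain n :: nat where n: "(norm x)\<^sup>2 / e\<^sup>2 < n"
    using reals_Archimedean2 by blast
  obtain J where J: "finite J" "card J = n" "J \<subseteq> {i\<in>I. e \<le> cmod (cinner x (v i))}"
    using infinite_arbitrarily_large[OF inf] by blast
  have "n * e\<^sup>2 = (\<Sum>i\<in>J. e\<^sup>2)" using J(2) by simp
  also have "\<dots> \<le> (\<Sum>i\<in>J. (cmod (cinner x (v i)))\<^sup>2)"
    using J(3) e by (intro sum_mono power_mono) auto
  also have "\<dots> \<le> (norm x)\<^sup>2"
    by (rule bessel_inequality[OF J(1)]) (use J(3) in \<open>intro v; blast\<close>)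
  finally show False using n e by (simp add: divide_less_eq)
qed

lemma countable_nonzero_coefficients:
  fixes v :: "'i \<Rightarrow> 'h::complex_hilbert_space"
  assumes v: "\<And>i j. i \<in> I \<Longrightarrow> j \<in> I \<Longrightarrow> cinner (v i) (v j) = (if i = j then 1 else 0)"
  shows "countable {i\<in>I. cinner x (v i) \<noteq> 0}"
proof -
  have "{i\<in>I. cinner x (v i) \<noteq> 0} = (\<Union>n. {i\<in>I. inverse (real (Suc n)) \<le> cmod (cinner x (v i))})"
  proof (intro equalityI subsetI)
    fix i assume "i \<in> {i\<in>I. cinner x (v i) \<noteq> 0}"
    then show "i \<in> (\<Union>n. {i\<in>I. inverse (real (Suc n)) \<le> cmod (cinner x (v i))})"
      using reals_Archimedean[of "cmod (cinner x (v i))"] by (auto intro: less_imp_le)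
  qed auto
  then show ?thesis
    using finite_large_coefficients[OF v] by (simp add: countable_finite)
qed

subsection \<open>The group von Neumann algebra of a direct sum of copies of $\mathbb{Z}/2$\<close>

lemma Fpow_sym_diff [simp]: "F \<in> Fpow K \<Longrightarrow> G \<in> Fpow K \<Longrightarrow> sym_diff F G \<in> Fpow K"
  by (auto simp: Fpow_def)

lemma Fpow_empty [simp]: "{} \<in> Fpow K" and Fpow_singleton [simp]: "{i} \<in> Fpow K \<longleftrightarrow> i \<in> K"
  by (auto simp: Fpow_def)

text \<open>The regular representation of the group of finite subsets of \<open>K\<close> under
  symmetric difference, in abstract form: \<open>b\<close> is the orthonormal basis of group
  elements and \<open>u i\<close> is translation by \<open>{i}\<close>. Totality is expressed
  through a trivial orthogonal complement.\<close>

locale rademacher_system =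
  fixes K :: "'k set" and u :: "'k \<Rightarrow> 'h::complex_hilbert_space \<Rightarrow> 'h" and b :: "'k set \<Rightarrow> 'h"
  assumes u_bounded: "i \<in> K \<Longrightarrow> u i \<in> bounded_ops"
    and u_adjoint: "i \<in> K \<Longrightarrow> is_adjoint (u i) (u i)"
    and u_b: "i \<in> K \<Longrightarrow> F \<in> Fpow K \<Longrightarrow> u i (b F) = b (sym_diff F {i})"
    and b_orthonormal: "F \<in> Fpow K \<Longrightarrow> G \<in> Fpow K \<Longrightarrow>
          cinner (b F) (b G) = (if F = G then 1 else 0)"
    and b_total: "(\<And>F. F \<in> Fpow K \<Longrightarrow> cinner y (b F) = 0) \<Longrightarrow> y = 0"
begin

definition N :: "('h \<Rightarrow> 'h) set" where
  "N = commutant id (commutant id (u ` K))"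

text \<open>Since totality speaks of orthogonality, the argument passes to the adjoint
  \<open>R\<close> of the difference: each \<open>R y\<close> is orthogonal to the whole
  basis.\<close>

lemma op_eqI:
  assumes S: "S \<in> bounded_ops" and T: "T \<in> bounded_ops"
    and eq: "\<And>F. F \<in> Fpow K \<Longrightarrow> S (b F) = T (b F)"
  shows "S = T"
proof -
  obtain R where R: "is_adjoint (\<lambda>x. S x - T x) R"
    using adjoint_exists[OF diff_bounded_ops[OF S T]] by blast
  have "R y = 0" for y
  proof (rule b_total)
    fix F assume "F \<in> Fpow K"
    then have "cinner (b F) (R y) = 0"
      using R eq by (simp flip: R[unfolded is_adjoint_def, rule_format])
    then show "cinner (R y) (b F) = 0" by (metis cinner_commute complex_cnj_zero)
  qed
  then have "cinner (S x - T x) y = 0" for x y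
    using R by (simp add: is_adjoint_def)
  then have "S x - T x = 0" for x
    using cinner_self_eq_0 by blast
  then show ?thesis by auto
qed

lemma matrix_eqI:
  assumes S: "S \<in> bounded_ops" and T: "T \<in> bounded_ops"
    and eq: "\<And>F G. F \<in> Fpow K \<Longrightarrow> G \<in> Fpow K \<Longrightarrow> cinner (S (b F)) (b G) = cinner (T (b F)) (b G)"
  shows "S = T"
proof (rule op_eqI[OF S T])
  fix F assume "F \<in> Fpow K"
  then have "S (b F) - T (b F) = 0"
    by (intro b_total) (simp add: cinner_diff_left eq)
  then show "S (b F) = T (b F)" by simp
qed

lemma b_insert: "i \<in> K \<Longrightarrow> i \<notin> F \<Longrightarrow> F \<in> Fpow K \<Longrightarrow> b (insert i F) = u i (b F)"
  using u_b[of i F] by simp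

lemma id_nonzero: "id \<noteq> (\<lambda>_::'h. 0)"
proof
  assume "id = (\<lambda>_::'h. 0)"
  then have "b {} = 0" by (metis id_apply)
  then show False using b_orthonormal[of "{}" "{}"] by simp
qed

lemma u_u: "i \<in> K \<Longrightarrow> u i (u i x) = x"
proof -
  assume i: "i \<in> K"
  have "u i \<circ> u i = id"
  proof (rule op_eqI)
    fix F assume "F \<in> Fpow K"
    moreover have "sym_diff (sym_diff F {i}) {i} = F" by blast
    ultimately show "(u i \<circ> u i) (b F) = id (b F)"
      using i by (simp add: u_b)
  qed (use i in \<open>simp_all add: u_bounded comp_bounded_ops\<close>)
  then show ?thesis by (simp add: fun_eq_iff)
qed

lemma u_in_commutant: "u ` K \<subseteq> commutant id (u ` K)"
proof -
  have "u i \<circ> u j = u j \<circ> u i" if "i \<in> K" "j \<in> K" for i j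
  proof (rule op_eqI)
    fix F assume "F \<in> Fpow K"
    moreover have "sym_diff (sym_diff F {j}) {i} = sym_diff (sym_diff F {i}) {j}" by blast
    ultimately show "(u i \<circ> u j) (b F) = (u j \<circ> u i) (b F)"
      using that by (simp add: u_b)
  qed (use that in \<open>simp_all add: u_bounded comp_bounded_ops\<close>)
  then show ?thesis
    by (auto simp: commutant_def u_bounded)
qed

lemma N_von_neumann_algebra: "von_neumann_algebra id N"
  unfolding N_def
  by (rule von_neumann_algebra_bicommutant) (use u_bounded u_adjoint in auto)

lemma N_abelian: "vn_abelian N"
  unfolding N_def by (rule vn_abelian_bicommutant(1)[OF u_in_commutant])

lemma N_bounded: "T \<in> N \<Longrightarrow> T \<in> bounded_ops"
  by (simp add: N_def commutant_id_iff)

lemma N_commute_u: "T \<in> N \<Longrightarrow> i \<in> K \<Longrightarrow> T (u i x) = u i (T x)"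
  using subsetD[OF vn_abelian_bicommutant(2)[OF u_in_commutant], of T]
  unfolding N_def[symmetric] commutant_id_iff[of T "u ` K"] by blast

lemma N_commute: "S \<in> N \<Longrightarrow> T \<in> N \<Longrightarrow> S \<circ> T = T \<circ> S"
  using N_abelian unfolding vn_abelian_def by blast

lemma N_comp: "S \<in> N \<Longrightarrow> T \<in> N \<Longrightarrow> S \<circ> T \<in> N"
  by (simp add: N_def commutant_id_iff comp_bounded_ops)

lemma N_diff: "S \<in> N \<Longrightarrow> T \<in> N \<Longrightarrow> (\<lambda>x. S x - T x) \<in> N"
  by (simp add: N_def commutant_id_iff diff_bounded_ops bounded_ops_linear)

lemma N_id: "id \<in> N"
  by (simp add: N_def commutant_id_iff)

lemma u_in_N: "i \<in> K \<Longrightarrow> u i \<in> N"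
  using subset_bicommutant[of "u ` K" id] u_bounded unfolding N_def by auto

text \<open>The spectral projection of the self-adjoint unitary \<open>u i\<close> for the
  eigenvalue 1. It replaces \<open>u i\<close> because generators must be projections.\<close>

definition e :: "'k \<Rightarrow> 'h \<Rightarrow> 'h" where
  "e i x = (1/2) *\<^sub>R (x + u i x)"

lemma e_bounded: "i \<in> K \<Longrightarrow> e i \<in> bounded_ops"
  unfolding e_def[abs_def]
  using scaleR_bounded_ops[OF add_bounded_ops[OF id_bounded_ops u_bounded]] by simp

lemma commutant_e: "commutant id (e ` K) = commutant id (u ` K)"
proof -
  have "T (e i x) = e i (T x) \<longleftrightarrow> T (u i x) = u i (T x)" if "T \<in> bounded_ops" for T i x
    using that by (simp add: e_def bounded_ops_linear)
  then show ?thesis by (auto simp: commutant_id_iff)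
qed

lemma N_eq_bicommutant_e: "N = commutant id (commutant id (e ` K))"
  by (simp add: N_def commutant_e)

lemma e_in_N: "i \<in> K \<Longrightarrow> e i \<in> N"
  unfolding N_eq_bicommutant_e using subset_bicommutant[of "e ` K" id] e_bounded by auto

lemma projection_e: "i \<in> K \<Longrightarrow> projection (e i)"
proof -
  assume i: "i \<in> K"
  have "x + u i x + (u i x + x) = 2 *\<^sub>R (x + u i x)" for x
    by (simp add: scaleR_2)
  then have "e i \<circ> e i = e i"
    using i by (simp add: fun_eq_iff e_def bounded_ops_linear u_bounded u_u flip: scaleR_add_right)
  then show ?thesis
    using u_adjoint[OF i]
    by (simp add: projection_def is_adjoint_def e_bounded i) (simp add: e_def cinner_simps)
qed

text \<open>Every \<open>b F\<close> arises from the vacuum by finitely many \<open>u i\<close>, and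
  \<open>T\<close> commutes with each of these.\<close>

lemma vacuum_separating:
  assumes T: "T \<in> N" and 0: "T (b {}) = 0"
  shows "T = (\<lambda>_. 0)"
proof (rule op_eqI)
  fix F assume F: "F \<in> Fpow K"
  then have "finite F" "F \<subseteq> K" by (auto simp: Fpow_def)
  then have "T (b F) = 0"
  proof (induction F rule: finite_subset_induct')
    case (insert i F)
    then have "b (insert i F) = u i (b F)"
      by (intro b_insert) (auto simp: Fpow_def)
    then show ?case
      using insert T by (simp add: N_commute_u bounded_ops_linear(5) u_bounded)
  qed (rule 0)
  then show "T (b F) = 0" .
qed (use T in \<open>simp_all add: N_bounded\<close>)

lemma vacuum_nonzero: "T \<in> N \<Longrightarrow> T \<noteq> (\<lambda>_. 0) \<Longrightarrow> T (b {}) \<noteq> 0"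
  using vacuum_separating by blast

text \<open>Elements of \<open>N\<close> are convolution operators: self-adjoint \<open>u i\<close>
  are moved across the inner product one by one until the first index is empty.\<close>

lemma N_matrix:
  assumes T: "T \<in> N" and F: "F \<in> Fpow K" and G: "G \<in> Fpow K"
  shows "cinner (T (b F)) (b G) = cinner (T (b {})) (b (sym_diff F G))"
proof -
  have "finite F" "F \<subseteq> K" using F by (auto simp: Fpow_def)
  then show ?thesis using G
  proof (induction F arbitrary: G rule: finite_subset_induct')
    case (insert i F)
    then have "b (insert i F) = u i (b F)"
      by (intro b_insert) (auto simp: Fpow_def)
    then have "cinner (T (b (insert i F))) (b G) = cinner (T (b F)) (u i (b G))"
      using insert T u_adjoint[of i] by (simp add: N_commute_u is_adjoint_def)
    also have "\<dots> = cinner (T (b F)) (b (sym_diff G {i}))"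
      using insert by (simp add: u_b)
    also have "\<dots> = cinner (T (b {})) (b (sym_diff F (sym_diff G {i})))"
      using insert by (intro insert.IH) simp
    also have "sym_diff F (sym_diff G {i}) = sym_diff (insert i F) G"
      using insert by blast
    finally show ?case .
  qed simp
qed

section \<open>Orthogonal families of projections and absence of minimal projections\<close>

lemma b_singleton: "i \<in> K \<Longrightarrow> b {i} = u i (b {})"
  using u_b[of i "{}"] by simp

text \<open>The normalized vectors \<open>p (b {})\<close> are orthonormal, and the vacuum has
  nonzero coefficient at each of them.\<close>

lemma orthogonal_projections_countable:
  assumes P: "orthogonal_projections N P"
  shows "countable P"
proof -
  let ?v = "\<lambda>p. (1 / norm (p (b {}))) *\<^sub>R p (b {})"
  have p: "p \<in> N" "projection p" "p (b {}) \<noteq> 0" if "p \<in> P" for p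
    using P that vacuum_nonzero[of p] by (auto simp: orthogonal_projections_def)
  have orth: "cinner (?v p) (?v q) = (if p = q then 1 else 0)" if "p \<in> P" "q \<in> P" for p q
  proof (cases "p = q")
    case False
    then have "q \<circ> p = (\<lambda>_. 0)"
      using P that by (auto simp: orthogonal_projections_def)
    then have "q (p (b {})) = 0" by (simp add: fun_eq_iff)
    moreover have "cinner (p (b {})) (q (b {})) = cinner (q (p (b {}))) (b {})"
      by (rule projectionD(4)[OF p(2)[OF that(2)], symmetric])
    ultimately show ?thesis
      using False by (simp add: cinner_simps)
  qed (use p that in \<open>simp add: cinner_simps cinner_self power2_eq_square\<close>)
  have "cinner (b {}) (?v p) \<noteq> 0" if "p \<in> P" for p
    using p[OF that] projectionD(4)[OF p(2)[OF that], of "b {}" "b {}", symmetric]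
    by (simp add: cinner_simps cinner_projection_self)
  then have eq: "{p\<in>P. cinner (b {}) (?v p) \<noteq> 0} = P" by blast
  have "countable {p\<in>P. cinner (b {}) (?v p) \<noteq> 0}"
    by (rule countable_nonzero_coefficients) (rule orth)
  then show ?thesis unfolding eq .
qed


lemma projection_u_dichotomy:
  assumes p: "p \<in> N" and i: "i \<in> K" and c: "e i \<circ> p = (\<lambda>_. 0) \<or> e i \<circ> p = p"
  shows "u i (p x) = p x \<or> u i (p x) = - p x"
proof -
  have "e i (p x) = 0 \<or> e i (p x) = p x"
    using c by (metis comp_apply)
  moreover have "u i (p x) = 2 *\<^sub>R e i (p x) - p x"
    by (simp add: e_def)
  ultimately show ?thesis by (auto simp: scaleR_2)
qed

lemma N_non_atomic:
  assumes K: "infinite K"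
  shows "vn_non_atomic N"
  unfolding vn_non_atomic_def
proof
  assume "\<exists>p. minimal_projection N p"
  then obtain p where p: "p \<in> N" "projection p" "p \<noteq> (\<lambda>_. 0)"
    and min: "\<And>q. q \<in> N \<Longrightarrow> projection q \<Longrightarrow> p \<circ> q = q \<Longrightarrow> q = (\<lambda>_. 0) \<or> q = p"
    unfolding minimal_projection_def by blast
  define c where "c = cmod (cinner (p (b {})) (b {}))"
  have c: "c > 0"
    using vacuum_nonzero[OF p(1,3)] by (simp add: c_def cinner_projection_self[OF p(2)])
  have "c \<le> cmod (cinner (p (b {})) (b {i}))" if i: "i \<in> K" for i
  proof -
    have comm: "e i \<circ> p = p \<circ> e i"
      using N_commute[OF e_in_N[OF i] p(1)] .
    have "p \<circ> (e i \<circ> p) = e i \<circ> p"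
      using comm projectionD(2)[OF p(2)] by (metis comp_assoc)
    \<comment> \<open>Minimality of \<open>p\<close>, applied to the subprojection
      \<open>e i \<circ> p\<close>, forces \<open>u i\<close> to act as a sign on the range of
      \<open>p\<close>; the coefficient at \<open>b {i}\<close> then has the modulus
      \<open>c\<close> of the one at the vacuum.\<close>
    then have "e i \<circ> p = (\<lambda>_. 0) \<or> e i \<circ> p = p"
      by (intro min N_comp e_in_N i p(1) projection_comp projection_e p(2) comm)
    then have "u i (p (b {})) = p (b {}) \<or> u i (p (b {})) = - p (b {})"
      using p(1) i by (intro projection_u_dichotomy)
    moreover have "cinner (p (b {})) (b {i}) = cinner (u i (p (b {}))) (b {})"
      using u_adjoint[OF i] by (simp add: b_singleton i is_adjoint_def)
    ultimately show ?thesis by (auto simp: c_def)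
  qed
  then have "{i\<in>K. c \<le> cmod (cinner (p (b {})) (b {i}))} = K" by blast
  moreover have "finite {i\<in>K. c \<le> cmod (cinner (p (b {})) (b {i}))}"
    by (rule finite_large_coefficients) (use c b_orthonormal in auto)
  ultimately show False using K by simp
qed

text \<open>Without minimal projections, dependent choice gives a strictly decreasing sequence of
  nonzero projections. Its successive differences \<open>d n\<close> are nonzero and mutually
  orthogonal.\<close>

lemma infinite_orthogonal_projections:
  assumes K: "infinite K"
  shows "\<exists>P. orthogonal_projections N P \<and> |P| =o natLeq"
proof -
  let ?Q = "\<lambda>q. q \<in> N \<and> projection q \<and> q \<noteq> (\<lambda>_. 0)"
  have id: "?Q id"
    using id_nonzero by (simp add: N_id)
  have "\<exists>r. ?Q r \<and> q \<circ> r = r \<and> r \<noteq> q" if "?Q q" for q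
    using N_non_atomic[OF K] that unfolding vn_non_atomic_def minimal_projection_def by blast
  then obtain q where q: "\<And>n::nat. ?Q (q n)" "\<And>n. q n \<circ> q (Suc n) = q (Suc n) \<and> q (Suc n) \<noteq> q n"
    using dependent_nat_choice[of "\<lambda>_. ?Q" "\<lambda>_ q r. q \<circ> r = r \<and> r \<noteq> q"] id by blast
  have mono: "q m \<circ> q n = q n" if "m \<le> n" for m n
    using that
  proof (induction rule: dec_induct)
    case base
    show ?case using q(1) projectionD(2) by blast
  next
    case (step n)
    then show ?case using q(2)[of n] by (metis comp_assoc)
  qed
  then have mono': "q n (q m x) = q n x" "q m (q n x) = q n x" if "m \<le> n" for m n x
    using that N_commute[of "q m" "q n"] q(1) by (metis comp_apply)+
  define d where "d n x = q n x - q (Suc n) x" for n x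
  have dN: "d n \<in> N" for n
    unfolding d_def[abs_def] using q(1) by (intro N_diff) auto
  have lin: "q n (x - y) = q n x - q n y" for n x y
    using q(1) N_bounded bounded_ops_linear(4) by blast
  have proj: "projection (d n)" for n
    unfolding projection_def
  proof (intro conjI)
    show "d n \<circ> d n = d n"
      by (simp add: fun_eq_iff d_def lin mono')
    show "is_adjoint (d n) (d n)"
      using q(1) by (simp add: is_adjoint_def d_def cinner_simps projectionD(4)[of "q _"])
  qed (use dN N_bounded in blast)
  have nz: "d n \<noteq> (\<lambda>_. 0)" for n
    using q(2)[of n] by (auto simp: d_def fun_eq_iff dest: sym)
  have orth: "d m \<circ> d n = (\<lambda>_. 0)" "d n \<circ> d m = (\<lambda>_. 0)" if "m < n" for m n
    using that by (simp_all add: fun_eq_iff d_def lin mono')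
  have idem: "d n \<circ> d n = d n" for n
    using proj projectionD(2) by blast
  have "inj d"
    by (rule linorder_injI) (metis idem nz orth(1))
  then have "|range d| =o |UNIV :: nat set|"
    by (meson bij_betw_imageI card_of_ordIsoI ordIso_symmetric)
  then have "|range d| =o natLeq"
    using card_of_nat ordIso_transitive by blast
  moreover have "orthogonal_projections N (range d)"
    unfolding orthogonal_projections_def using dN proj nz orth by (auto, metis linorder_neqE_nat)
  ultimately show ?thesis by blast
qed

lemma N_sigma_finite: "infinite K \<Longrightarrow> vn_sigma_finite N"
  unfolding vn_sigma_finite_def
  using infinite_orthogonal_projections orthogonal_projections_countable
  by (auto simp: countable_card_le_natLeq)

subsection \<open>Homogeneity\<close>

text \<open>The projections in \<open>S\<close> are treated one at a time: \<open>r\<close> is kept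
  if \<open>s\<close> annihilates it and is otherwise cut down to
  \<open>r \<circ> s\<close>.\<close>

lemma exists_compatible_projection:
  assumes "finite S" "S \<subseteq> N" "\<And>s. s \<in> S \<Longrightarrow> projection s"
    and p: "p \<in> N" "projection p" "p \<noteq> (\<lambda>_. 0)"
  shows "\<exists>r\<in>N. projection r \<and> r \<noteq> (\<lambda>_. 0) \<and> p \<circ> r = r \<and>
    (\<forall>s\<in>S. s \<circ> r = r \<or> s \<circ> r = (\<lambda>_. 0))"
  using assms(1-3)
proof (induction S rule: finite_induct)
  case empty
  then show ?case using p projectionD(2) by blast
next
  case (insert s S)
  then obtain r where r: "r \<in> N" "projection r" "r \<noteq> (\<lambda>_. 0)" "p \<circ> r = r"
    "\<And>t. t \<in> S \<Longrightarrow> t \<circ> r = r \<or> t \<circ> r = (\<lambda>_. 0)" by (metis insert_subset insertCI)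
  show ?case
  proof (cases "s \<circ> r = (\<lambda>_. 0)")
    case True
    then show ?thesis using r by blast
  next
    case False
    have s: "s \<in> N" "projection s" using insert by auto
    have sr: "s \<circ> r = r \<circ> s" using N_commute s r by blast
    have "t \<circ> (r \<circ> s) = r \<circ> s \<or> t \<circ> (r \<circ> s) = (\<lambda>_. 0)" if "t \<in> S" for t
      using r(5)[OF that] by (metis comp_apply comp_assoc ext)
    moreover have "s \<circ> (s \<circ> r) = s \<circ> r" "p \<circ> (r \<circ> s) = r \<circ> s"
      using projectionD(2)[OF s(2)] r(4) by (metis comp_assoc)+
    moreover have "projection (r \<circ> s)"
      using projection_comp[OF r(2) s(2) sr[symmetric]] .
    ultimately show ?thesis
      using False N_comp[OF r(1) s(1)] unfolding sr by (metis insertE)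
  qed
qed

text \<open>If finitely many projections generated the reduced algebra, a nonzero projection below
  \<open>p\<close> that is compatible with all of them would be minimal, since the commutant contains all
  rank one operators on its range.\<close>

lemma infinite_generating_set:
  assumes K: "infinite K" and p: "p \<in> N" "projection p" "p \<noteq> (\<lambda>_. 0)"
    and S: "S \<subseteq> N" "\<And>s. s \<in> S \<Longrightarrow> projection s"
    and gen: "(\<lambda>T. T \<circ> p) ` N \<subseteq> commutant p (commutant p S)"
  shows "infinite S"
proof
  assume "finite S"
  then obtain r where r: "r \<in> N" "projection r" "r \<noteq> (\<lambda>_. 0)" "p \<circ> r = r"
    and compat: "\<And>s. s \<in> S \<Longrightarrow> s \<circ> r = r \<or> s \<circ> r = (\<lambda>_. 0)"
    using exists_compatible_projection[of S p] S p by blast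
  have "q = r" if q: "q \<in> N" "projection q" "r \<circ> q = q" "q \<noteq> (\<lambda>_. 0)" for q
  proof (rule ccontr)
    assume "q \<noteq> r"
    then obtain w where w: "r w - q w \<noteq> 0" by (metis ext right_minus_eq)
    obtain v where v: "q v \<noteq> 0" using q(4) by (auto simp: fun_eq_iff)
    define w' where "w' = r w - q w"
    define v' where "v' = q v"
    \<comment> \<open>A rank one operator from the range of \<open>r - q\<close> to the range of
      \<open>q\<close>. Each \<open>s\<close> in \<open>S\<close> acts on the range of
      \<open>r\<close> as 0 or as the identity, so \<open>R\<close> commutes with \<open>S\<close>;
      it does not commute with \<open>q\<close>.\<close>
    define R where "R x = cinner x w' *\<^sub>C v'" for x
    have lin: "T (x - y) = T x - T y" "T (c *\<^sub>C x) = c *\<^sub>C T x" if "T \<in> N" for T x y c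
      using that N_bounded bounded_ops_linear by blast+
    have rq: "r (q x) = q x" "q (r x) = q x" "r (r x) = r x" "q (q x) = q x" "p (r x) = r x"
      "p (q x) = q x" "q (p x) = q x" for x
      using q(3) N_commute[OF r(1) q(1)] projectionD(3)[OF r(2)] projectionD(3)[OF q(2)] r(4)
        N_commute[OF p(1) q(1)] by (metis comp_apply)+
    have fix_r: "r v' = v'" "r w' = w'" "p v' = v'" "p w' = w'" "q v' = v'" "q w' = 0"
      by (simp_all add: v'_def w'_def lin p r q rq)
    have "R \<in> bounded_ops"
    proof (rule bounded_opsI)
      show "norm (R x) \<le> norm x * (norm w' * norm v')" for x
        using mult_right_mono[OF norm_cinner_le[of x w'], of "norm v'"]
        by (simp add: R_def norm_scaleC mult.assoc)
    qed (simp_all add: R_def cinner_simps scaleC_add_left scaleC_scaleC)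
    moreover have "p (R (p x)) = R x" for x
      by (simp add: R_def lin p projectionD(4)[OF p(2)] fix_r)
    moreover have "R (s x) = s (R x)" if s: "s \<in> S" for s x
    proof -
      have "(s v' = v' \<and> s w' = w') \<or> (s v' = 0 \<and> s w' = 0)"
        using compat[OF s] fix_r by (metis comp_apply)
      moreover have "s \<in> N" "projection s" using S s by auto
      ultimately show ?thesis
        by (auto simp: R_def lin projectionD(4)[of s])
    qed
    ultimately have "R \<in> commutant p S"
      by (simp add: commutant_def fun_eq_iff)
    then have "(q \<circ> p) (R w') = R ((q \<circ> p) w')"
      using gen q(1) by (intro commutant_commute[of _ p "commutant p S"]) blast+
    then have "cinner w' w' *\<^sub>C v' = 0"
      by (simp add: R_def rq lin q fix_r)
    then have "cmod (cinner w' w') * norm v' = 0"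
      by (metis norm_scaleC norm_zero)
    then show False using v w by (simp add: v'_def w'_def)
  qed
  then have "minimal_projection N r"
    unfolding minimal_projection_def using r by blast
  then show False
    using N_non_atomic[OF K] unfolding vn_non_atomic_def by blast
qed

text \<open>\<open>E\<close> projects onto the vectors that do not involve coordinate
  \<open>i\<close>. Defining \<open>V\<close> by vanishing coefficients makes it closed at
  once.\<close>

lemma exists_conditional_expectation:
  assumes i: "i \<in> K"
  obtains E where "projection E" "E (b {}) = b {}" "E (b {i}) = 0"
    "\<forall>T\<in>N. (\<forall>F\<in>Fpow K. i \<in> F \<longrightarrow> cinner (T (b {})) (b F) = 0) \<longrightarrow> E \<circ> T = T \<circ> E"
proof -
  define V where "V = (\<Inter>F\<in>{F\<in>Fpow K. i \<in> F}. {x. cinner x (b F) = 0})"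
  have "closed V"
    unfolding V_def by (intro closed_INT ballI closed_cinner_zero)
  moreover have "0 \<in> V" "\<And>x y. x \<in> V \<Longrightarrow> y \<in> V \<Longrightarrow> x + y \<in> V" "\<And>c x. x \<in> V \<Longrightarrow> c *\<^sub>C x \<in> V"
    by (simp_all add: V_def cinner_simps)
  ultimately obtain E where E: "projection E" "\<And>x. E x \<in> V"
      "\<And>x v. v \<in> V \<Longrightarrow> cinner (x - E x) v = 0"
    by (rule closed_subspace_projection) (assumption | rule that)+
  have in_V: "b F \<in> V" if "F \<in> Fpow K" "i \<notin> F" for F
    using that b_orthonormal[of F] by (auto simp: V_def)
  have Eb1: "E (b F) = b F" if "F \<in> Fpow K" "i \<notin> F" for F
  proof -
    have "E (b F - E (b F)) = 0"
      using projectionD(3)[OF E(1)] bounded_ops_linear(4)[OF projectionD(1)[OF E(1)]] by simp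
    then have "cinner (b F - E (b F)) (E (b F)) = 0"
      by (metis E(2,3))
    then have "cinner (b F - E (b F)) (b F - E (b F)) = 0"
      using E(3)[OF in_V[OF that], of "b F"] by (simp add: cinner_diff_right)
    then show ?thesis by simp
  qed
  have Eb0: "E (b F) = 0" if "F \<in> Fpow K" "i \<in> F" for F
  proof -
    have "cinner (E (b F)) (E (b F)) = cinner (E (b F)) (b F)"
      by (metis projectionD(3,4)[OF E(1)])
    also have "\<dots> = 0" using E(2)[of "b F"] that by (auto simp: V_def)
    finally show ?thesis by simp
  qed
  have "E \<circ> T = T \<circ> E"
    if T: "T \<in> N" and 0: "\<And>F. F \<in> Fpow K \<Longrightarrow> i \<in> F \<Longrightarrow> cinner (T (b {})) (b F) = 0" for T
  proof (rule matrix_eqI)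
    fix F G assume FG: "F \<in> Fpow K" "G \<in> Fpow K"
    \<comment> \<open>By \<open>N_matrix\<close> the entry depends only on the symmetric difference,
      so the matrix of \<open>T\<close> is block diagonal with respect to membership of
      \<open>i\<close>.\<close>
    have "cinner (T (b F)) (b G) = 0" if "i \<in> sym_diff F G"
      unfolding N_matrix[OF T FG] using FG that by (intro 0) simp_all
    moreover have "T 0 = 0" using T N_bounded bounded_ops_linear(5) by blast
    ultimately show "cinner ((E \<circ> T) (b F)) (b G) = cinner ((T \<circ> E) (b F)) (b G)"
      using FG by (cases "i \<in> F"; cases "i \<in> G") (auto simp: projectionD(4)[OF E(1)] Eb0 Eb1)
  qed (use T E(1) in \<open>simp_all add: comp_bounded_ops N_bounded projectionD\<close>)
  then show ?thesis
    using that E(1) Eb1[of "{}"] Eb0[of "{i}"] i by simp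
qed

lemma card_generating_set:
  assumes K: "infinite K" and p: "p \<in> N" "projection p" "p \<noteq> (\<lambda>_. 0)"
    and S: "S \<subseteq> N" "\<And>s. s \<in> S \<Longrightarrow> projection s \<and> p \<circ> s = s \<and> s \<circ> p = s"
    and gen: "(\<lambda>T. T \<circ> p) ` N \<subseteq> commutant p (commutant p S)"
  shows "|K| \<le>o |S|"
proof (rule ccontr)
  assume "\<not> |K| \<le>o |S|"
  then have less: "|S| <o |K|" by (simp add: card_of_Well_order not_ordLeq_iff_ordLess)
  have inf: "infinite S"
    using infinite_generating_set[OF K p S(1) _ gen] S(2) by blast
  \<comment> \<open>All coordinates that occur in the expansions of \<open>T (b {})\<close> for
    \<open>T\<close> in \<open>S\<close> and for \<open>T = p\<close>. Each expansion is countable,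
    so infinity of \<open>S\<close> bounds \<open>J\<close> by the cardinality of
    \<open>S\<close>.\<close>
  define J where "J = (\<Union>T\<in>insert p S. \<Union>F\<in>{F\<in>Fpow K. cinner (T (b {})) (b F) \<noteq> 0}. F)"
  have "|\<Union>F\<in>{F\<in>Fpow K. cinner (T (b {})) (b F) \<noteq> 0}. F| \<le>o |S|" for T
  proof -
    have "countable {F\<in>Fpow K. cinner (T (b {})) (b F) \<noteq> 0}"
      by (rule countable_nonzero_coefficients) (rule b_orthonormal)
    then have "countable (\<Union>F\<in>{F\<in>Fpow K. cinner (T (b {})) (b F) \<noteq> 0}. F)"
      by (rule countable_UN) (auto simp: Fpow_def countable_finite)
    then have "|\<Union>F\<in>{F\<in>Fpow K. cinner (T (b {})) (b F) \<noteq> 0}. F| \<le>o natLeq"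
      unfolding countable_card_le_natLeq .
    moreover have "natLeq \<le>o |S|"
      using inf infinite_iff_natLeq_ordLeq by blast
    ultimately show ?thesis by (rule ordLeq_transitive)
  qed
  moreover have "|insert p S| \<le>o |S|"
  proof -
    have "S \<noteq> {}" using inf by auto
    then show ?thesis
      using card_of_Un_ordLeq_infinite_Field[of "|S|" "{p}" S] inf
      by (simp add: Field_card_of card_of_card_order_on card_of_singl_ordLeq card_of_refl ordIso_imp_ordLeq)
  qed
  ultimately have "|J| \<le>o |S|"
    unfolding J_def using inf by (intro card_of_UNION_ordLeq_infinite) auto
  then have "|J| <o |K|"
    using less by (rule ordLeq_ordLess_trans)
  then have "\<not> K \<subseteq> J"
    using card_of_mono1[of K J] not_ordLess_ordLeq[of "|J|" "|K|"] by argo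
  then obtain i where i: "i \<in> K" "i \<notin> J" by blast
  obtain E where E: "projection E" "E (b {}) = b {}" "E (b {i}) = 0"
    "\<forall>T\<in>N. (\<forall>F\<in>Fpow K. i \<in> F \<longrightarrow> cinner (T (b {})) (b F) = 0) \<longrightarrow> E \<circ> T = T \<circ> E"
    by (rule exists_conditional_expectation[OF i(1)])
  have comm: "E (T x) = T (E x)" if "T \<in> insert p S" for T x
  proof -
    have "E \<circ> T = T \<circ> E"
      by (rule E(4)[rule_format]) (use that i(2) p(1) S(1) in \<open>auto simp: J_def\<close>)
    then show ?thesis by (metis comp_apply)
  qed
  have pp: "p (p x) = p x" for x using projectionD(3)[OF p(2)] .
  have "p \<circ> E \<in> commutant p S"
  proof -
    have "p (E (s x)) = s (p (E x))" if "s \<in> S" for s x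
      using S(2)[OF that] comm[of s] that by (metis comp_apply insertCI)
    moreover have "E (p x) = p (E x)" for x using comm by simp
    ultimately show ?thesis
      by (simp add: commutant_def fun_eq_iff comp_bounded_ops projectionD(1) p(2) E(1) pp)
  qed
  moreover have "u i \<circ> p \<in> commutant p (commutant p S)"
    using gen u_in_N[OF i(1)] by blast
  \<comment> \<open>Evaluated at the vacuum: \<open>E\<close> fixes it on the left, whereas on the
    right \<open>u i\<close> first moves it to \<open>b {i}\<close>, which \<open>E\<close>
    annihilates.\<close>
  ultimately have "(u i \<circ> p) ((p \<circ> E) (b {})) = (p \<circ> E) ((u i \<circ> p) (b {}))"
    by (rule commutant_commute[rotated])
  then have "u i (p (b {})) = p (E (u i (p (b {}))))"
    by (simp add: pp E(2))
  also have "\<dots> = p (E (b {i}))"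
    using p(1) i comm[of p] by (simp add: N_commute_u[symmetric] pp b_singleton)
  also have "\<dots> = 0"
    using N_bounded[OF p(1)] by (simp add: E(3) bounded_ops_linear)
  finally have "u i (u i (p (b {}))) = 0"
    using bounded_ops_linear(5)[OF u_bounded[OF i(1)]] by simp
  then show False
    using vacuum_nonzero[OF p(1,3)] u_u[OF i(1)] by simp
qed

text \<open>The projections \<open>e i \<circ> p\<close> give the upper bound and
  \<open>card_generating_set\<close> the lower one; the whole algebra is the case
  \<open>p = id\<close>.\<close>

lemma N_homogeneous:
  fixes \<kappa> :: "'k rel"
  assumes K: "infinite K" and \<kappa>: "|K| =o \<kappa>"
  shows "vn_homogeneous \<kappa> N"
proof -
  have *: "\<kappa> =o vn_gen_card p ((\<lambda>T. T \<circ> p) ` N)"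
    if p: "p \<in> N" "projection p" "p \<noteq> (\<lambda>_. 0)" for p
  proof (rule ordIso_vn_gen_card)
    show "generating_projections p ((\<lambda>T. T \<circ> p) ` N) ((\<lambda>T. T \<circ> p) ` e ` K)"
      using e_in_N projection_e N_eq_bicommutant_e
      by (intro generating_projections_reduced N_von_neumann_algebra N_abelian p) auto
    show "|(\<lambda>T. T \<circ> p) ` e ` K| \<le>o \<kappa>"
      unfolding image_image using ordLeq_ordIso_trans[OF card_of_image \<kappa>] .
    fix S assume "generating_projections p ((\<lambda>T. T \<circ> p) ` N) S"
    note S = generating_projections_reducedD[OF N_von_neumann_algebra N_abelian p(1,2) this]
    have "|K| \<le>o |S|"
      using K p S by (intro card_generating_set) auto
    then show "\<kappa> \<le>o |S|"
      by (rule ordIso_ordLeq_trans[OF ordIso_symmetric[OF \<kappa>]])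
  qed
  show ?thesis
    using *[of id] * id_nonzero N_id by (simp add: vn_homogeneous_def Setcompr_eq_image)
qed

end

subsection \<open>The infinite tensor product and its product state\<close>

text \<open>The C*-identity and submultiplicativity give one inequality; applying it to
  \<open>star A x\<close> gives the other.\<close>

lemma (in cstar_algebra) cnorm_star: "x \<in> carrier A \<Longrightarrow> cnorm A (star A x) = cnorm A x"
proof -
  have le: "cnorm A x \<le> cnorm A (star A x)" if x: "x \<in> carrier A" for x
  proof (cases "cnorm A x = 0")
    case False
    have "cnorm A x * cnorm A x \<le> cnorm A (star A x) * cnorm A x"
      using cnorm_mult[OF star_closed[OF x] x] cstar_identity[OF x] by (simp add: power2_eq_square)
    then show ?thesis using False cnorm_nonneg[OF x] by simp
  qed (use cnorm_nonneg star_closed x in simp)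
  assume "x \<in> carrier A"
  then show ?thesis
    using le[of x] le[of "star A x"] star_closed star_star by (simp add: antisym)
qed

text \<open>Together with the constant 1 an orthonormal basis of the two-dimensional algebra for the
  inner product given by \<open>tau\<close>.\<close>

definition rad :: "bool \<Rightarrow> complex" where
  "rad t = (if t then 1 else -1)"

lemma rad_simps [simp]: "rad t * rad t = 1" "cnj (rad t) = rad t" "tau rad = 0"
  by (simp_all add: rad_def tau_def)

lemma elem_tensor_closed [simp]: "elem_tensor F a \<in> carrier (fin_tensor F)"
  by (simp add: fin_tensor_def elem_tensor_def)

lemma elem_tensor_cong: "(\<And>i. i \<in> F \<Longrightarrow> a i = a' i) \<Longrightarrow> elem_tensor F a = elem_tensor F a'"
  by (simp add: elem_tensor_def fun_eq_iff)

section \<open>Elementary tensors in the inductive limit\<close>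

locale tensor_gns =
  fixes K :: "'k set" and A :: "'a cstar" and \<iota> :: "'k set \<Rightarrow> (('k \<Rightarrow> bool) \<Rightarrow> complex) \<Rightarrow> 'a"
    and \<phi> :: "'a \<Rightarrow> complex" and \<eta> :: "'a \<Rightarrow> 'h::complex_hilbert_space" and \<pi> :: "'a \<Rightarrow> 'h \<Rightarrow> 'h"
  assumes tensor: "infinite_tensor K A \<iota>" and state: "product_state K A \<iota> \<phi>"
    and gns: "gns_representation A \<phi> \<eta> \<pi>"
begin

sublocale cstar_algebra A
  using tensor by (simp add: infinite_tensor_def cstar_inductive_limit_def)

lemma \<iota>_hom:
  assumes "F \<in> Fpow K"
  shows "\<iota> F \<in> ring_hom (fin_tensor F) A"
    and "x \<in> carrier (fin_tensor F) \<Longrightarrow> \<iota> F (scale (fin_tensor F) c x) = scale A c (\<iota> F x)"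
    and "x \<in> carrier (fin_tensor F) \<Longrightarrow> \<iota> F (star (fin_tensor F) x) = star A (\<iota> F x)"
  using tensor assms
  by (auto simp: infinite_tensor_def cstar_inductive_limit_def cstar_hom_def Fpow_def)

lemma \<iota>_embed:
  assumes "G \<in> Fpow K" "F \<subseteq> G" "x \<in> carrier (fin_tensor F)"
  shows "\<iota> G (tensor_embed F G x) = \<iota> F x"
proof -
  have "\<forall>F\<in>{F. finite F \<and> F \<subseteq> K}. \<forall>G\<in>{F. finite F \<and> F \<subseteq> K}. F \<subseteq> G \<longrightarrow>
      (\<forall>x\<in>carrier (fin_tensor F). \<iota> G (tensor_embed F G x) = \<iota> F x)"
    using tensor unfolding infinite_tensor_def cstar_inductive_limit_def by (elim conjE)
  moreover have "finite F" "F \<subseteq> K" "finite G" "G \<subseteq> K"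
    using assms finite_subset by (auto simp: Fpow_def)
  ultimately show ?thesis using assms(2,3) by blast
qed

definition el :: "'k set \<Rightarrow> ('k \<Rightarrow> bool \<Rightarrow> complex) \<Rightarrow> 'a" where
  "el F a = \<iota> F (elem_tensor F a)"

lemma el_closed [simp]: "F \<in> Fpow K \<Longrightarrow> el F a \<in> carrier A"
  using ring_hom_closed[OF \<iota>_hom(1)] by (simp add: el_def)

lemma el_cong: "(\<And>i. i \<in> F \<Longrightarrow> a i = a' i) \<Longrightarrow> el F a = el F a'"
  unfolding el_def using elem_tensor_cong by metis

lemma el_extend:
  assumes "G \<in> Fpow K" "F \<subseteq> G"
  shows "el F a = el G (\<lambda>i. if i \<in> F then a i else (\<lambda>_. 1))"
proof -
  have "finite G" using assms(1) by (simp add: Fpow_def)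
  then show ?thesis
    unfolding el_def tensor_embed_elem_tensor[OF \<open>finite G\<close> assms(2), symmetric]
    using assms by (simp add: \<iota>_embed)
qed

lemma el_mult:
  assumes "F \<in> Fpow K" "G \<in> Fpow K"
  shows "el F a \<otimes>\<^bsub>A\<^esub> el G a' =
    el (F \<union> G) (\<lambda>i x. (if i \<in> F then a i x else 1) * (if i \<in> G then a' i x else 1))"
proof -
  have U: "F \<union> G \<in> Fpow K" using assms by (auto simp: Fpow_def)
  have eq: "(\<lambda>i x. (if i \<in> F then a i else (\<lambda>_. 1)) x * (if i \<in> G then a' i else (\<lambda>_. 1)) x) =
      (\<lambda>i x. (if i \<in> F then a i x else 1) * (if i \<in> G then a' i x else 1))"
    by (auto simp: fun_eq_iff)
  show ?thesis
    unfolding el_extend[OF U Un_upper1, of a] el_extend[OF U Un_upper2, of a']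
    by (simp add: el_def elem_tensor_mult eq flip: ring_hom_mult[OF \<iota>_hom(1)[OF U]])
qed

lemma el_star: "F \<in> Fpow K \<Longrightarrow> star A (el F a) = el F (\<lambda>i x. cnj (a i x))"
  by (simp add: el_def elem_tensor_star flip: \<iota>_hom(3))

lemma el_empty: "el {} a = \<one>\<^bsub>A\<^esub>"
  using ring_hom_one[OF \<iota>_hom(1)[OF Fpow_empty]] elem_tensor_cong[of "{}" a "\<lambda>_ _. 1"]
  by (simp add: el_def elem_tensor_one)

lemma \<phi>_el: "F \<in> Fpow K \<Longrightarrow> \<phi> (el F a) = (\<Prod>i\<in>F. tau (a i))"
  using state by (simp add: product_state_def el_def Fpow_def)

text \<open>The Walsh functions: \<open>c {i}\<close> will act as the unitary \<open>u i\<close>,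
  and \<open>\<eta> (c F)\<close> will be the basis vector indexed by \<open>F\<close>.\<close>

abbreviation c :: "'k set \<Rightarrow> 'a" where
  "c F \<equiv> el F (\<lambda>_. rad)"

text \<open>On common coordinates the factors multiply to 1 and drop out.\<close>

lemma c_mult:
  assumes F: "F \<in> Fpow K" and G: "G \<in> Fpow K"
  shows "c F \<otimes>\<^bsub>A\<^esub> c G = c (sym_diff F G)"
proof -
  have U: "F \<union> G \<in> Fpow K" using assms by (auto simp: Fpow_def)
  have "c (sym_diff F G) = el (F \<union> G) (\<lambda>i. if i \<in> sym_diff F G then rad else (\<lambda>_. 1))"
    by (rule el_extend[OF U]) blast
  also have "\<dots> = c F \<otimes>\<^bsub>A\<^esub> c G"
    unfolding el_mult[OF F G] by (rule el_cong) (auto simp: fun_eq_iff)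
  finally show ?thesis by simp
qed

text \<open>Every function on two points is a combination of 1 and \<open>rad\<close>. Peeling off
  one coordinate in this way builds all elementary tensors from the unit and the
  \<open>c {i}\<close>.\<close>

lemma el_insert:
  assumes i: "i \<in> K" "i \<notin> F" and F: "F \<in> Fpow K"
  shows "el (insert i F) a = scale A ((a i True + a i False) / 2) (el F a)
    \<oplus>\<^bsub>A\<^esub> scale A ((a i True - a i False) / 2) (c {i} \<otimes>\<^bsub>A\<^esub> el F a)"
proof -
  let ?G = "insert i F" and ?s = "(a i True + a i False) / 2" and ?d = "(a i True - a i False) / 2"
  have G: "?G \<in> Fpow K" "finite ?G" using F i by (auto simp: Fpow_def)
  have "a = a(i := \<lambda>t. ?s * 1 + ?d * rad t)"
    by (auto simp: fun_eq_iff rad_def field_simps)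
  then have "elem_tensor ?G a = elem_tensor ?G (a(i := \<lambda>t. ?s * 1 + ?d * rad t))"
    by simp
  also have "\<dots> = scale (fin_tensor ?G) ?s (elem_tensor ?G (a(i := \<lambda>_. 1)))
      \<oplus>\<^bsub>fin_tensor ?G\<^esub> scale (fin_tensor ?G) ?d (elem_tensor ?G (a(i := rad)))"
    unfolding elem_tensor_add[OF G(2) insertI1] elem_tensor_scale[OF G(2) insertI1]
    by (simp add: fin_tensor_def)
  finally have "el ?G a = scale A ?s (el ?G (a(i := \<lambda>_. 1))) \<oplus>\<^bsub>A\<^esub> scale A ?d (el ?G (a(i := rad)))"
    unfolding el_def
    by (simp add: ring_hom_add[OF \<iota>_hom(1)[OF G(1)]] \<iota>_hom(2)[OF G(1)]
        cstar_algebra.scale_closed[OF fin_tensor_cstar_algebra[OF G(2)]])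
  also have "el ?G (a(i := \<lambda>_. 1)) = el F a"
    unfolding el_extend[OF G(1) subset_insertI, of a] using i by (intro el_cong) auto
  also have "el ?G (a(i := rad)) = c {i} \<otimes>\<^bsub>A\<^esub> el F a"
    using i F by (subst el_mult) (auto intro!: el_cong simp: fun_eq_iff)
  finally show ?thesis .
qed

text \<open>The \<open>c {i}\<close> generate \<open>A\<close> as a C*-algebra: they yield the
  elementary tensors, these include the point masses that span each finite level, and the finite
  levels are dense.\<close>

lemma tensor_induct [consumes 1, case_names one mult add scale limit]:
  assumes a: "a \<in> carrier A"
    and one: "Q \<one>\<^bsub>A\<^esub>"
    and mult: "\<And>i a. i \<in> K \<Longrightarrow> a \<in> carrier A \<Longrightarrow> Q a \<Longrightarrow> Q (c {i} \<otimes>\<^bsub>A\<^esub> a)"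
    and add: "\<And>a a'. a \<in> carrier A \<Longrightarrow> a' \<in> carrier A \<Longrightarrow> Q a \<Longrightarrow> Q a' \<Longrightarrow> Q (a \<oplus>\<^bsub>A\<^esub> a')"
    and scale: "\<And>z a. a \<in> carrier A \<Longrightarrow> Q a \<Longrightarrow> Q (scale A z a)"
    and limit: "\<And>a. a \<in> carrier A \<Longrightarrow>
      (\<And>e. e > 0 \<Longrightarrow> \<exists>x\<in>carrier A. Q x \<and> cnorm A (a \<ominus>\<^bsub>A\<^esub> x) < e) \<Longrightarrow> Q a"
  shows "Q a"
proof -
  have el: "Q (el F f)" if "F \<in> Fpow K" for F f
  proof -
    from that have "finite F" "F \<subseteq> K" by (auto simp: Fpow_def)
    then show ?thesis
    proof (induction F rule: finite_subset_induct')
      case empty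
      then show ?case by (simp add: el_empty one)
    next
      case (insert i F)
      then have F: "F \<in> Fpow K" by (simp add: Fpow_def)
      show ?case
        unfolding el_insert[OF insert(2,4) F]
        by (intro add scale mult insert scale_closed m_closed el_closed F) (simp_all add: insert(2))
    qed
  qed
  have fin: "Q (\<iota> F x)" if F: "F \<in> Fpow K" and x: "x \<in> carrier (fin_tensor F)" for F x
  proof -
    have finF: "finite F" using F by (simp add: Fpow_def)
    have "Q (\<iota> F (\<lambda>t. if t \<in> Y then x t else 0))" if "finite Y" "Y \<subseteq> points F" for Y
      using that
    proof (induction Y rule: finite_subset_induct')
      case empty
      \<comment> \<open>The zero function is obtained as a multiple of the unit, since the induction
        cases do not include zero.\<close>
      have "(\<lambda>t. 0) = scale (fin_tensor F) 0 (elem_tensor F (\<lambda>_ _. 1))"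
        by (simp add: fin_tensor_def)
      then show ?case
        using scale[OF el_closed[OF F] el[OF F], of 0 "\<lambda>_ _. 1"]
        by (simp add: el_def \<iota>_hom(2)[OF F])
    next
      case (insert y Y)
      let ?x = "\<lambda>t. if t \<in> Y then x t else 0" and ?y = "elem_tensor F (\<lambda>i. indicator {y i})"
      have "(\<lambda>t. if t \<in> insert y Y then x t else 0) =
          scale (fin_tensor F) (x y) ?y \<oplus>\<^bsub>fin_tensor F\<^esub> ?x"
        unfolding elem_tensor_basis[OF finF insert(2)]
        by (rule ext) (use insert(4) in \<open>auto simp: fin_tensor_def indicator_def\<close>)
      moreover have cl: "?x \<in> carrier (fin_tensor F)" "scale (fin_tensor F) (x y) ?y \<in> carrier (fin_tensor F)"
        using x by (auto simp: fin_tensor_def elem_tensor_def)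
      ultimately have "\<iota> F (\<lambda>t. if t \<in> insert y Y then x t else 0) =
          scale A (x y) (el F (\<lambda>i. indicator {y i})) \<oplus>\<^bsub>A\<^esub> \<iota> F ?x"
        by (simp add: ring_hom_add[OF \<iota>_hom(1)[OF F]] \<iota>_hom(2)[OF F] el_def)
      then show ?case
        using insert el[OF F] F ring_hom_closed[OF \<iota>_hom(1)[OF F] cl(1)]
        by (simp add: add scale scale_closed)
    qed
    moreover have "(\<lambda>t. if t \<in> points F then x t else 0) = x"
      by (rule ext) (use x in \<open>auto simp: fin_tensor_def\<close>)
    ultimately show ?thesis
      using finite_points[OF finF] by (metis order_refl)
  qed
  show ?thesis
  proof (rule limit[OF a])
    fix e :: real assume "e > 0"
    then obtain F x where "F \<in> Fpow K" "x \<in> carrier (fin_tensor F)" "cnorm A (a \<ominus>\<^bsub>A\<^esub> \<iota> F x) < e"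
      using tensor a unfolding infinite_tensor_def cstar_inductive_limit_def Fpow_def by blast
    then show "\<exists>x\<in>carrier A. Q x \<and> cnorm A (a \<ominus>\<^bsub>A\<^esub> x) < e"
      using fin ring_hom_closed[OF \<iota>_hom(1)] by blast
  qed
qed

section \<open>The GNS representation\<close>

lemma \<eta>_simps:
  assumes "a \<in> carrier A" "a' \<in> carrier A"
  shows "\<eta> (a \<oplus>\<^bsub>A\<^esub> a') = \<eta> a + \<eta> a'" "\<eta> (scale A z a) = z *\<^sub>C \<eta> a"
    and "cinner (\<eta> a) (\<eta> a') = \<phi> (star A a' \<otimes>\<^bsub>A\<^esub> a)"
    and "\<pi> a (\<eta> a') = \<eta> (a \<otimes>\<^bsub>A\<^esub> a')"
  using gns assms by (simp_all add: gns_representation_def)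

lemma \<pi>_bounded: "a \<in> carrier A \<Longrightarrow> \<pi> a \<in> bounded_ops"
  using gns by (simp add: gns_representation_def)

lemma minus_add_cancel': "a \<in> carrier A \<Longrightarrow> x \<in> carrier A \<Longrightarrow> (a \<ominus>\<^bsub>A\<^esub> x) \<oplus>\<^bsub>A\<^esub> x = a"
  by (simp add: a_minus_def a_assoc l_neg)

lemma norm_\<eta>_le:
  assumes a: "a \<in> carrier A"
  shows "norm (\<eta> a) \<le> cnorm A a"
proof -
  have "of_real ((norm (\<eta> a))\<^sup>2) = \<phi> (star A a \<otimes>\<^bsub>A\<^esub> a)"
    using \<eta>_simps(3)[OF a a] by (simp add: cinner_self)
  then have "(norm (\<eta> a))\<^sup>2 = cmod (\<phi> (star A a \<otimes>\<^bsub>A\<^esub> a))"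
    by (metis abs_power2 norm_of_real real_norm_def)
  also have "\<dots> \<le> (cnorm A a)\<^sup>2"
    using state a by (simp add: product_state_def cstar_state_def star_closed flip: cstar_identity)
  finally show ?thesis
    using cnorm_nonneg[OF a] by (rule power2_le_imp_le)
qed

lemma closed_\<eta>_eq_UNIV:
  assumes "closed C" "\<And>a. a \<in> carrier A \<Longrightarrow> \<eta> a \<in> C"
  shows "x \<in> C"
proof -
  have "closure (\<eta> ` carrier A) \<subseteq> C"
    using assms by (intro closure_minimal) auto
  then show ?thesis using gns by (auto simp: gns_representation_def)
qed

lemma \<eta>_total:
  assumes "\<And>a. a \<in> carrier A \<Longrightarrow> cinner y (\<eta> a) = 0"
  shows "y = 0"
proof -
  have "y \<in> {x. cinner x y = 0}"
    by (rule closed_\<eta>_eq_UNIV[OF closed_cinner_zero]) (use assms cinner_eq_0_commute in blast)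
  then show ?thesis by simp
qed

lemma op_\<eta>_eqI:
  assumes "S \<in> bounded_ops" "T \<in> bounded_ops" "\<And>a. a \<in> carrier A \<Longrightarrow> S (\<eta> a) = T (\<eta> a)"
  shows "S x = T x"
proof -
  have "closed {x. S x = T x}"
    using assms by (intro closed_Collect_eq linear_continuous_on bounded_ops_linear)
  then show ?thesis
    using closed_\<eta>_eq_UNIV[of "{x. S x = T x}"] assms(3) by auto
qed

lemma \<pi>_one [simp]: "\<pi> \<one>\<^bsub>A\<^esub> x = x"
  using op_\<eta>_eqI[of "\<pi> \<one>\<^bsub>A\<^esub>" id] by (simp add: \<pi>_bounded \<eta>_simps)

text \<open>The construction prescribes \<open>\<pi> a\<close> only on the image of
  \<open>\<eta>\<close>; the laws hold there and extend by density and boundedness.\<close>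

lemma \<pi>_simps:
  assumes a: "a \<in> carrier A" and a': "a' \<in> carrier A"
  shows "\<pi> (a \<otimes>\<^bsub>A\<^esub> a') x = \<pi> a (\<pi> a' x)" "\<pi> (a \<oplus>\<^bsub>A\<^esub> a') x = \<pi> a x + \<pi> a' x"
    "\<pi> (scale A z a) x = z *\<^sub>C \<pi> a x"
proof -
  show "\<pi> (a \<otimes>\<^bsub>A\<^esub> a') x = \<pi> a (\<pi> a' x)"
    using op_\<eta>_eqI[of "\<pi> (a \<otimes>\<^bsub>A\<^esub> a')" "\<pi> a \<circ> \<pi> a'"] a a'
    by (simp add: \<pi>_bounded \<eta>_simps comp_bounded_ops m_assoc)
  show "\<pi> (a \<oplus>\<^bsub>A\<^esub> a') x = \<pi> a x + \<pi> a' x"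
    using op_\<eta>_eqI[of "\<pi> (a \<oplus>\<^bsub>A\<^esub> a')" "\<lambda>x. \<pi> a x + \<pi> a' x"] a a'
    by (simp add: \<pi>_bounded \<eta>_simps add_bounded_ops l_distr)
  have "(\<lambda>x. z *\<^sub>C \<pi> a x) \<in> bounded_ops"
    using scaleC_bounded_ops[OF \<pi>_bounded[OF a]] .
  then show "\<pi> (scale A z a) x = z *\<^sub>C \<pi> a x"
    using op_\<eta>_eqI[of "\<pi> (scale A z a)" "\<lambda>x. z *\<^sub>C \<pi> a x"] a
    by (simp add: \<pi>_bounded \<eta>_simps scale_closed scale_mult_left)
qed

text \<open>On the dense image of \<open>\<eta>\<close> both sides are \<open>\<phi>\<close> of the
  same product. Comparing \<open>\<pi> (star A a)\<close> with the Hilbert space adjoint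
  \<open>S\<close> carries this over to all vectors.\<close>

lemma \<pi>_adjoint:
  assumes a: "a \<in> carrier A"
  shows "cinner (\<pi> a x) y = cinner x (\<pi> (star A a) y)"
proof -
  have sa: "star A a \<in> carrier A" using a by (rule star_closed)
  obtain S where S: "S \<in> bounded_ops" "is_adjoint (\<pi> a) S"
    using adjoint_exists[OF \<pi>_bounded[OF a]] by blast
  have "S (\<eta> y) = \<pi> (star A a) (\<eta> y)" if y: "y \<in> carrier A" for y
  proof -
    have "cinner (\<eta> x) (S (\<eta> y)) = cinner (\<eta> x) (\<pi> (star A a) (\<eta> y))" if x: "x \<in> carrier A" for x
    proof -
      have "cinner (\<eta> x) (S (\<eta> y)) = cinner (\<pi> a (\<eta> x)) (\<eta> y)"
        using S(2) by (simp add: is_adjoint_def)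
      also have "\<dots> = cinner (\<eta> x) (\<pi> (star A a) (\<eta> y))"
        using a sa x y by (simp add: \<eta>_simps star_mult star_star m_assoc star_closed)
      finally show ?thesis .
    qed
    then have "cinner (S (\<eta> y) - \<pi> (star A a) (\<eta> y)) (\<eta> x) = 0" if "x \<in> carrier A" for x
      using that by (subst cinner_eq_0_commute) (simp add: cinner_diff_right)
    then have "S (\<eta> y) - \<pi> (star A a) (\<eta> y) = 0" by (rule \<eta>_total)
    then show ?thesis by simp
  qed
  then have "S y = \<pi> (star A a) y" for y
    using op_\<eta>_eqI[OF S(1) \<pi>_bounded[OF sa]] by blast
  then show ?thesis
    using S(2) by (simp add: is_adjoint_def)
qed

abbreviation u :: "'k \<Rightarrow> 'h \<Rightarrow> 'h" where
  "u i \<equiv> \<pi> (c {i})"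

lemma u_self_adjoint: "i \<in> K \<Longrightarrow> cinner (u i x) y = cinner x (u i y)"
  by (subst \<pi>_adjoint) (simp_all add: el_star)

lemma u_\<eta>: "i \<in> K \<Longrightarrow> F \<in> Fpow K \<Longrightarrow> u i (\<eta> (c F)) = \<eta> (c (sym_diff F {i}))"
  by (simp add: \<eta>_simps c_mult Un_commute)

lemma \<eta>_c_total:
  assumes "\<And>F. F \<in> Fpow K \<Longrightarrow> cinner y (\<eta> (c F)) = 0"
  shows "y = 0"
proof (rule \<eta>_total)
  fix a assume "a \<in> carrier A"
  \<comment> \<open>The vector \<open>y\<close> stays universally quantified, because the
    multiplication case applies the hypothesis to \<open>u i y\<close>.\<close>
  then have "\<forall>y. (\<forall>F\<in>Fpow K. cinner y (\<eta> (c F)) = 0) \<longrightarrow> cinner y (\<eta> a) = 0"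
  proof (induction rule: tensor_induct)
    case one
    then show ?case by (metis Fpow_empty el_empty)
  next
    case (mult i a)
    show ?case
    proof (intro allI impI)
      fix y assume y: "\<forall>F\<in>Fpow K. cinner y (\<eta> (c F)) = 0"
      have "cinner (u i y) (\<eta> (c F)) = 0" if "F \<in> Fpow K" for F
        unfolding u_self_adjoint[OF mult(1)] u_\<eta>[OF mult(1) that]
        using y that mult(1) by simp
      then have "cinner (u i y) (\<eta> a) = 0" using mult(3) by blast
      then show "cinner y (\<eta> (c {i} \<otimes>\<^bsub>A\<^esub> a)) = 0"
        using mult(1,2) by (simp add: u_self_adjoint \<eta>_simps)
    qed
  next
    case (limit a)
    show ?case
    proof (intro allI impI)
      fix y assume y: "\<forall>F\<in>Fpow K. cinner y (\<eta> (c F)) = 0"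
      have "cmod (cinner y (\<eta> a)) \<le> 0 + r" if r: "r > 0" for r
      proof -
        \<comment> \<open>The summand 1 in the denominator keeps it positive when
          \<open>y = 0\<close>.\<close>
        obtain x where x: "x \<in> carrier A" "cinner y (\<eta> x) = 0"
            "cnorm A (a \<ominus>\<^bsub>A\<^esub> x) < r / (norm y + 1)"
          using limit(2)[of "r / (norm y + 1)"] divide_pos_pos[OF r, of "norm y + 1"] y
          by (auto simp: add_nonneg_pos)
        have "\<eta> a = \<eta> (a \<ominus>\<^bsub>A\<^esub> x) + \<eta> x"
          using limit(1) x(1) by (simp add: minus_add_cancel' flip: \<eta>_simps(1))
        then have "cmod (cinner y (\<eta> a)) \<le> norm y * norm (\<eta> (a \<ominus>\<^bsub>A\<^esub> x))"
          using norm_cinner_le x(2) by (simp add: cinner_simps)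
        also have "\<dots> \<le> norm y * (r / (norm y + 1))"
          using norm_\<eta>_le[of "a \<ominus>\<^bsub>A\<^esub> x"] limit(1) x by (intro mult_left_mono) auto
        also have "\<dots> \<le> r"
          using r pos_divide_le_eq[of "norm y + 1" "norm y * r" r]
          by (simp add: add_pos_nonneg algebra_simps)
        finally show ?thesis by simp
      qed
      then have "cmod (cinner y (\<eta> a)) \<le> 0" by (rule field_le_epsilon)
      then show "cinner y (\<eta> a) = 0" by simp
    qed
  qed (simp_all add: \<eta>_simps cinner_simps)
  then show "cinner y (\<eta> a) = 0" using assms by blast
qed

text \<open>Orthonormality holds because \<open>\<phi>\<close> of \<open>c (sym_diff G F)\<close> is
  a product of the values \<open>tau rad = 0\<close>, which is 1 only over the empty set.\<close>

sublocale rademacher_system K u "\<lambda>F. \<eta> (c F)"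
proof
  fix F G assume FG: "F \<in> Fpow K" "G \<in> Fpow K"
  have "cinner (\<eta> (c F)) (\<eta> (c G)) = \<phi> (c (sym_diff G F))"
    using FG by (simp add: \<eta>_simps el_star c_mult)
  also have "\<dots> = (if F = G then 1 else 0)"
    unfolding \<phi>_el[OF Fpow_sym_diff[OF FG(2,1)]] using FG by (auto simp: Fpow_def)
  finally show "cinner (\<eta> (c F)) (\<eta> (c G)) = (if F = G then 1 else 0)" .
qed (simp_all add: \<pi>_bounded is_adjoint_def u_self_adjoint u_\<eta> \<eta>_c_total)

text \<open>In the limit step \<open>\<pi>\<close> is not known to be contractive; instead the commutator with \<open>R\<close> is
  tested against the dense subspace, where its matrix elements are norm continuous.\<close>

lemma commute_\<pi>:
  assumes R: "R \<in> commutant id (u ` K)" and a: "a \<in> carrier A"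
  shows "R (\<pi> a x) = \<pi> a (R x)"
proof -
  have Rb: "R \<in> bounded_ops" and Ru: "\<And>i x. i \<in> K \<Longrightarrow> R (u i x) = u i (R x)"
    using R by (auto simp: commutant_id_iff)
  from a have "\<forall>x. R (\<pi> a x) = \<pi> a (R x)"
  proof (induction rule: tensor_induct)
    case (limit a)
    obtain S where "is_adjoint R S"
      using adjoint_exists[OF Rb] by blast
    then have S: "\<And>x y. cinner (R x) y = cinner x (S y)"
      by (simp add: is_adjoint_def)
    have "R (\<pi> a (\<eta> d)) = \<pi> a (R (\<eta> d))" if d: "d \<in> carrier A" for d
    proof -
      have "cinner (R (\<pi> a (\<eta> d)) - \<pi> a (R (\<eta> d))) (\<eta> d') = 0" if d': "d' \<in> carrier A" for d'
      proof -
        let ?m = "\<lambda>a. cinner (R (\<pi> a (\<eta> d)) - \<pi> a (R (\<eta> d))) (\<eta> d')"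
        define B where "B = cnorm A d * norm (S (\<eta> d')) + norm (R (\<eta> d)) * cnorm A d'"
        have B: "B \<ge> 0" using d d' by (simp add: B_def cnorm_nonneg)
        have bound: "cmod (?m z) \<le> cnorm A z * B" if z: "z \<in> carrier A" for z
        proof -
          have zd: "norm (\<eta> (z \<otimes>\<^bsub>A\<^esub> d)) \<le> cnorm A z * cnorm A d"
            using norm_\<eta>_le[of "z \<otimes>\<^bsub>A\<^esub> d"] cnorm_mult[of z d] z d by simp
          have zd': "norm (\<eta> (star A z \<otimes>\<^bsub>A\<^esub> d')) \<le> cnorm A z * cnorm A d'"
            using norm_\<eta>_le[of "star A z \<otimes>\<^bsub>A\<^esub> d'"] cnorm_mult[of "star A z" d'] z d'
            by (simp add: star_closed cnorm_star)
          \<comment> \<open>Moving \<open>R\<close> and \<open>\<pi> z\<close> to their adjoints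
            leaves \<open>z\<close> only inside \<open>\<eta>\<close>, where
            \<open>norm_\<eta>_le\<close> controls it.\<close>
          have "?m z = cinner (\<eta> (z \<otimes>\<^bsub>A\<^esub> d)) (S (\<eta> d')) - cinner (R (\<eta> d)) (\<eta> (star A z \<otimes>\<^bsub>A\<^esub> d'))"
            using z d d' by (simp add: cinner_diff_left S \<pi>_adjoint \<eta>_simps star_closed)
          also have "cmod \<dots> \<le> norm (\<eta> (z \<otimes>\<^bsub>A\<^esub> d)) * norm (S (\<eta> d'))
              + norm (R (\<eta> d)) * norm (\<eta> (star A z \<otimes>\<^bsub>A\<^esub> d'))"
            by (rule order_trans[OF norm_triangle_ineq4]) (intro add_mono norm_cinner_le)
          also have "\<dots> \<le> (cnorm A z * cnorm A d) * norm (S (\<eta> d'))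
              + norm (R (\<eta> d)) * (cnorm A z * cnorm A d')"
            using zd zd' by (intro add_mono mult_right_mono mult_left_mono) auto
          also have "\<dots> = cnorm A z * B" by (simp add: B_def algebra_simps)
          finally show ?thesis .
        qed
        have "cmod (?m a) \<le> 0 + r" if r: "r > 0" for r
        proof -
          obtain x where x: "x \<in> carrier A" "\<forall>y. R (\<pi> x y) = \<pi> x (R y)"
              "cnorm A (a \<ominus>\<^bsub>A\<^esub> x) < r / (B + 1)"
            using limit(2)[of "r / (B + 1)"] r B by auto
          have "\<pi> a y = \<pi> (a \<ominus>\<^bsub>A\<^esub> x) y + \<pi> x y" for y
            using limit(1) x(1) by (simp add: minus_add_cancel' flip: \<pi>_simps(2))
          \<comment> \<open>The approximant \<open>x\<close> already commutes with \<open>R\<close>,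
            so only the small difference contributes.\<close>
          then have "?m a = ?m (a \<ominus>\<^bsub>A\<^esub> x)"
            using x(2) by (simp add: bounded_ops_linear[OF Rb])
          then have "cmod (?m a) \<le> cnorm A (a \<ominus>\<^bsub>A\<^esub> x) * B"
            using bound[of "a \<ominus>\<^bsub>A\<^esub> x"] limit(1) x(1) by simp
          also have "\<dots> \<le> r / (B + 1) * B"
            using x(3) B by (intro mult_right_mono) auto
          also have "\<dots> \<le> r"
            using r B by (simp add: divide_le_eq algebra_simps)
          finally show ?thesis by simp
        qed
        then have "cmod (?m a) \<le> 0" by (rule field_le_epsilon)
        then show ?thesis by simp
      qed
      then have "R (\<pi> a (\<eta> d)) - \<pi> a (R (\<eta> d)) = 0" by (rule \<eta>_total)
      then show ?thesis by simp
    qed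
    then show ?case
      using op_\<eta>_eqI[of "R \<circ> \<pi> a" "\<pi> a \<circ> R"] limit(1) Rb by (simp add: comp_bounded_ops \<pi>_bounded)
  qed (simp_all add: \<pi>_simps bounded_ops_linear[OF Rb] Ru)
  then show ?thesis by blast
qed

text \<open>Equal commutants have equal bicommutants, which identifies the algebra generated by the
  representation with \<open>N\<close> of the Rademacher system.\<close>

lemma commutant_\<pi>: "commutant id (\<pi> ` carrier A) = commutant id (u ` K)"
proof
  show "commutant id (\<pi> ` carrier A) \<subseteq> commutant id (u ` K)"
    by (rule commutant_antimono) auto
  show "commutant id (u ` K) \<subseteq> commutant id (\<pi> ` carrier A)"
  proof
    fix R assume R: "R \<in> commutant id (u ` K)"
    then show "R \<in> commutant id (\<pi> ` carrier A)"
      using commute_\<pi>[OF R] by (simp add: commutant_id_iff)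
  qed
qed

end

theorem proposition9p18:
  fixes \<kappa> :: "'k rel"
    and A :: "'a cstar"
    and \<iota> :: "'k set \<Rightarrow> (('k \<Rightarrow> bool) \<Rightarrow> complex) \<Rightarrow> 'a"
    and \<phi> :: "'a \<Rightarrow> complex"
    and \<eta> :: "'a \<Rightarrow> 'h::complex_hilbert_space"
    and \<pi> :: "'a \<Rightarrow> 'h \<Rightarrow> 'h"
    and N :: "('h \<Rightarrow> 'h) set"
  assumes "Card_order \<kappa>" and "infinite (Field \<kappa>)"
    and "infinite_tensor (Field \<kappa>) A \<iota>"
    and "product_state (Field \<kappa>) A \<iota> \<phi>"
    and "gns_representation A \<phi> \<eta> \<pi>"
    and "N = commutant id (commutant id (\<pi> ` carrier A))"
  shows "von_neumann_algebra id N \<and> vn_abelian N \<and> vn_sigma_finite N \<and> vn_non_atomic N \<and>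
    vn_homogeneous \<kappa> N"
proof -
  interpret T: tensor_gns "Field \<kappa>" A \<iota> \<phi> \<eta> \<pi>
    using assms by unfold_locales
  have N: "N = T.N"
    unfolding T.N_def assms(6) T.commutant_\<pi> ..
  show ?thesis
    unfolding N
    using T.N_von_neumann_algebra T.N_abelian T.N_sigma_finite[OF assms(2)]
      T.N_non_atomic[OF assms(2)] T.N_homogeneous[OF assms(2) card_of_Field_ordIso[OF assms(1)]]
    by blast
qed

end
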